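(* Let $E$ be the limit set of a supercritical fractal percolation process in $[0,1]^d$ with parameters $b,p$, and let $m=pb^d$. Then almost surely, conditioned on nonextinction, there exists a sequence of subsets $D_n\subseteq E$ which are hyperplane diffuse and Ahlfors-regular with $\dim_H(D_n)$ increasing to $\log_bm$.
   Context: Fractal percolation with integer $b\ge2$ and $p\in(0,1)$: let $\Lambda=\{0,\dots,b-1\}^d$ and let $T$ be the Galton–Watson tree with alphabet $\Lambda$ and offspring distribution $W$ with $\mathbb{P}(W=B)=p^{|B|}(1-p)^{|\Lambda\setminus B|}$ ($B\subseteq\Lambda$): $T_0=\{\emptyset\}$, $T_n=\{aj:a\in T_{n-1},j\in W_a\}$ with independent copies $W_a$. The limit set is $E=\gamma_b(\partial T)$ where $\gamma_b(i)=\sum_{k\ge1}b^{-k}i_k$ and $\partial T$ is the set of infinite words all of whose prefixes lie in $T$ (equivalently, iteratively retain each $b$-adic subcube independently with probability $p$ and intersect). Supercritical means $m=pb^d>1$; nonextinction means $T_n\ne\emptyset$ for all $n$. A closed set $D$ is hyperplane diffuse if there are $\beta,\xi_0>0$ such that for all $\xi\in(0,\xi_0)$, $x\in D$ and affine hyperplanes $\mathcal{L}$, $D\cap B_\xi(x)\setminus\mathcal{L}^{(\beta\xi)}\ne\emptyset$ ($\mathcal{L}^{(\varepsilon)}$ the open $\varepsilon$-neighborhood). $D$ is Ahlfors-regular if it is the support of a measure $\mu$ with $c_1\rho^\delta\le\mu(B_\rho(x))\le c_2\rho^\delta$ for some $\delta,c_1,c_2>0$, all $\rho\in(0,1)$ and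 $x\in D$. *)

theory Defs
  imports "HOL-Probability.Probability"
begin

definition diam_pow :: "real \<Rightarrow> 'a::metric_space set \<Rightarrow> ennreal" where
  "diam_pow s U = (if U = {} then 0 else if s = 0 then 1 else ennreal (diameter U powr s))"

definition hausdorff_content_delta :: "real \<Rightarrow> real \<Rightarrow> 'a::metric_space set \<Rightarrow> ennreal" where
  "hausdorff_content_delta s \<delta> A =
     (INF U \<in> {U :: nat \<Rightarrow> 'a set. A \<subseteq> (\<Union>i. U i) \<and> (\<forall>i. bounded (U i) \<and> diameter (U i) \<le> \<delta>)}.
        (\<Sum>i. diam_pow s (U i)))"

definition hausdorff_measure :: "real \<Rightarrow> 'a::metric_space set \<Rightarrow> ennreal" where
  "hausdorff_measure s A = (SUP \<delta> \<in> {0<..}. hausdorff_content_delta s \<delta> A)"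

definition hausdorff_dim :: "'a::metric_space set \<Rightarrow> real" where
  "hausdorff_dim A = Inf {s. s \<ge> 0 \<and> hausdorff_measure s A = 0}"

definition affine_hyperplanes :: "'a::euclidean_space set set" where
  "affine_hyperplanes = {{x. a \<bullet> x = c} | a c. a \<noteq> 0}"

definition open_nbhd :: "'a::metric_space set \<Rightarrow> real \<Rightarrow> 'a set" where
  "open_nbhd L \<epsilon> = {y. \<exists>z\<in>L. dist y z < \<epsilon>}"

definition hyperplane_diffuse :: "'a::euclidean_space set \<Rightarrow> bool" where
  "hyperplane_diffuse D \<longleftrightarrow> closed D \<and>
     (\<exists>\<beta> \<xi>0. \<beta> > 0 \<and> \<xi>0 > 0 \<and>
        (\<forall>\<xi>. 0 < \<xi> \<and> \<xi> < \<xi>0 \<longrightarrow> (\<forall>x\<in>D. \<forall>L\<in>affine_hyperplanes.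
            D \<inter> ball x \<xi> - open_nbhd L (\<beta> * \<xi>) \<noteq> {})))"

definition measure_support :: "'a::metric_space measure \<Rightarrow> 'a set" where
  "measure_support \<mu> = {x. \<forall>r>0. emeasure \<mu> (ball x r) > 0}"

definition ahlfors_regular :: "'a::metric_space set \<Rightarrow> bool" where
  "ahlfors_regular D \<longleftrightarrow>
     (\<exists>\<mu> \<delta> c1 c2. sets \<mu> = sets borel \<and> \<delta> > 0 \<and> c1 > 0 \<and> c2 > 0 \<and>
        D = measure_support \<mu> \<and>
        (\<forall>x\<in>D. \<forall>\<rho>. 0 < \<rho> \<and> \<rho> < 1 \<longrightarrow>
           ennreal (c1 * \<rho> powr \<delta>) \<le> emeasure \<mu> (ball x \<rho>) \<and>
           emeasure \<mu> (ball x \<rho>) \<le> ennreal (c2 * \<rho> powr \<delta>)))"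

text \<open>Dimension d = CARD('n). The alphabet \<Lambda> = {0..b-1}^d is represented by functions
  'n \<Rightarrow> nat with values < b. A sample point \<omega> assigns to every nonempty word w an
  independent Bernoulli(p) bit \<omega> w ("the subcube w is retained"). The children of a
  word a are W_a = {j \<in> \<Lambda>. \<omega> (a @ [j])}, so the W_a are independent with
  P(W_a = B) = p^|B| (1-p)^|\<Lambda>-B|.\<close>

definition alphabet :: "nat \<Rightarrow> ('n::finite \<Rightarrow> nat) set" where
  "alphabet b = {j. \<forall>i. j i < b}"

definition perc_space :: "real \<Rightarrow> (('n::finite \<Rightarrow> nat) list \<Rightarrow> bool) measure" where
  "perc_space p = PiM UNIV (\<lambda>_. measure_pmf (bernoulli_pmf p))"

text \<open>w \<in> T, where T_n = {a j. a \<in> T_(n-1), j \<in> W_a}, T_0 = {[]}.\<close>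
definition in_tree :: "nat \<Rightarrow> (('n::finite \<Rightarrow> nat) list \<Rightarrow> bool) \<Rightarrow> ('n \<Rightarrow> nat) list \<Rightarrow> bool" where
  "in_tree b \<omega> w \<longleftrightarrow> set w \<subseteq> alphabet b \<and> (\<forall>k. 1 \<le> k \<and> k \<le> length w \<longrightarrow> \<omega> (take k w))"

definition nonextinct :: "nat \<Rightarrow> (('n::finite \<Rightarrow> nat) list \<Rightarrow> bool) \<Rightarrow> bool" where
  "nonextinct b \<omega> \<longleftrightarrow> (\<forall>n. \<exists>w. length w = n \<and> in_tree b \<omega> w)"

text \<open>Boundary \<partial>T: infinite words i = i_1 i_2 ... (here s k = i_(k+1)) all of whose
  finite prefixes lie in T.\<close>
definition tree_boundary :: "nat \<Rightarrow> (('n::finite \<Rightarrow> nat) list \<Rightarrow> bool) \<Rightarrow> (nat \<Rightarrow> ('n \<Rightarrow> nat)) set" where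
  "tree_boundary b \<omega> = {s. \<forall>n. in_tree b \<omega> (map s [0..<n])}"

definition gamma_b :: "nat \<Rightarrow> (nat \<Rightarrow> ('n::finite \<Rightarrow> nat)) \<Rightarrow> real ^ 'n" where
  "gamma_b b s = (\<chi> i. \<Sum>k. real (s k i) / real b ^ Suc k)"

definition limit_set :: "nat \<Rightarrow> (('n::finite \<Rightarrow> nat) list \<Rightarrow> bool) \<Rightarrow> (real ^ 'n) set" where
  "limit_set b \<omega> = gamma_b b ` tree_boundary b \<omega>"

end

theory Submission
  imports Defs
begin

text \<open>
  Cut the tree into blocks of \<open>n + 2\<close> generations and look for a subtree in which every block
  vertex \<open>w\<close> has, for each letter \<open>j\<close>, exactly \<open>K\<close> block children \<open>w j j u\<close>. Its image \<open>D\<close> carries the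
  uniform measure, which is Ahlfors regular of exponent \<open>log b (b^d K) / (n + 2)\<close>, and the repeated
  letters \<open>j j\<close> put points of \<open>D\<close> near all corners of every cube, which makes \<open>D\<close> hyperplane diffuse.

  If a vertex starts such a subtree of finite depth with probability \<open>q\<close>, then the number of
  descendants \<open>n\<close> generations below that do so has mean \<open>m^n q\<close> and, by a second moment recursion, is at
  least half its mean with a probability bounded below independently of \<open>n\<close> and \<open>q\<close>, provided
  \<open>q m^n \<ge> 1\<close>. Hence, for large \<open>n\<close>, a suitable \<open>K\<close> of order \<open>m^n\<close> gives a lower bound for \<open>q\<close> that
  persists as the depth grows, and infinite subtrees exist with positive probability. Having no vertex
  with such a subtree is an inherited property; its probability is a subsolution of the fixed point
  equation for the extinction probability, so by strict convexity it equals the extinction probability.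
\<close>

subsection \<open>Independence in the tree of bits\<close>

text \<open>The difficulty is the order of the choices. A regular subtree needs \<open>K\<close>
  close to the mean \<open>m^n q\<close>, but \<open>q\<close>, the probability that a descendant
  succeeds, itself depends on \<open>K\<close> and \<open>n\<close>. The second moment constant
  depends on neither, so a lower bound for \<open>q\<close> can be fixed in advance as the cost of
  one block: \<open>p^2\<close> and this constant for each of the \<open>b^d\<close> letters. Only
  then is \<open>n\<close> taken large, and \<open>K\<close> about half of \<open>m^n\<close> times
  that bound. Everything lost on the way (the bound itself, the rounding, the two forced letters) is
  a factor in the number \<open>b^d K\<close> of children that stays bounded as \<open>n\<close>
  grows, so it disappears when the logarithm is divided by \<open>n + 2\<close>. The subset for a
  given \<open>n\<close> starts at some vertex and not at the root, because at the root the event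
  has only positive probability; the starting vertex affects constants but not the exponent.\<close>

lemma alphabet_eq_PiE: "alphabet b = PiE UNIV (\<lambda>_::'n::finite. {..<b})"
  by (auto simp: alphabet_def)

lemma finite_alphabet [simp]: "finite (alphabet b :: ('n::finite \<Rightarrow> nat) set)"
  by (simp add: alphabet_eq_PiE finite_PiE)

lemma card_alphabet: "card (alphabet b :: ('n::finite \<Rightarrow> nat) set) = b ^ CARD('n)"
  by (simp add: alphabet_eq_PiE card_PiE)

definition sub :: "'a list \<Rightarrow> ('a list \<Rightarrow> bool) \<Rightarrow> 'a list \<Rightarrow> bool" where
  "sub w \<omega> = (\<lambda>u. \<omega> (w @ u))"

lemma sub_Nil [simp]: "sub [] \<omega> = \<omega>"
  by (simp add: sub_def)

lemma sub_sub: "sub w (sub v \<omega>) = sub (v @ w) \<omega>"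
  by (simp add: sub_def)

lemma sub_apply: "sub w \<omega> u = \<omega> (w @ u)"
  by (simp add: sub_def)

lemma in_tree_Nil [simp]: "in_tree b \<omega> []"
  by (simp add: in_tree_def)

lemma in_tree_append: "in_tree b \<omega> (v @ w) \<longleftrightarrow> in_tree b \<omega> v \<and> in_tree b (sub v \<omega>) w"
proof -
  have "(\<forall>k. 1 \<le> k \<and> k \<le> length v + length w \<longrightarrow> \<omega> (take k (v @ w))) \<longleftrightarrow>
     (\<forall>k. 1 \<le> k \<and> k \<le> length v \<longrightarrow> \<omega> (take k v)) \<and>
     (\<forall>k. 1 \<le> k \<and> k \<le> length w \<longrightarrow> \<omega> (v @ take k w))" (is "?L \<longleftrightarrow> ?R1 \<and> ?R2")
  proof (intro iffI conjI)
    assume L: ?L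
    show ?R1
    proof (intro allI impI)
      fix k assume "1 \<le> k \<and> k \<le> length v"
      then show "\<omega> (take k v)" using L[rule_format, of k] by simp
    qed
    show ?R2
    proof (intro allI impI)
      fix k assume "1 \<le> k \<and> k \<le> length w"
      then show "\<omega> (v @ take k w)" using L[rule_format, of "length v + k"] by simp
    qed
  next
    assume R: "?R1 \<and> ?R2"
    show ?L
    proof (intro allI impI)
      fix k assume k: "1 \<le> k \<and> k \<le> length v + length w"
      show "\<omega> (take k (v @ w))"
      proof (cases "k \<le> length v")
        case True
        then show ?thesis using R k by simp
      next
        case False
        then have "1 \<le> k - length v \<and> k - length v \<le> length w" using k by linarith
        then have "\<omega> (v @ take (k - length v) w)" using R by blast
        then show ?thesis using False by simp
      qed
    qed
  qed
  then show ?thesis unfolding in_tree_def sub_def by auto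
qed

lemma in_tree_single: "in_tree b \<omega> [j] \<longleftrightarrow> j \<in> alphabet b \<and> \<omega> [j]"
proof -
  have "in_tree b \<omega> [j] \<longleftrightarrow> j \<in> alphabet b \<and> (\<forall>k. k = 1 \<longrightarrow> \<omega> (take k [j]))"
    by (simp only: in_tree_def) (auto simp: le_Suc_eq)
  then show ?thesis by simp
qed

lemma in_tree_Cons:
  "in_tree b \<omega> (j # u) \<longleftrightarrow> j \<in> alphabet b \<and> \<omega> [j] \<and> in_tree b (sub [j] \<omega>) u"
  using in_tree_append[of b \<omega> "[j]" u] by (simp add: in_tree_single)

lemma space_perc_space [simp]: "space (perc_space p) = UNIV"
  by (simp add: perc_space_def space_PiM)

lemma prob_space_perc_space: "prob_space (perc_space p)"
  unfolding perc_space_def by (intro prob_space_PiM measure_pmf.prob_space_axioms)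

lemma measurable_perc_coord [measurable]:
  "(\<lambda>\<omega>. \<omega> w) \<in> measurable (perc_space p) (count_space UNIV)"
proof -
  have "(\<lambda>\<omega>. \<omega> w) \<in> measurable (perc_space p) (measure_pmf (bernoulli_pmf p))"
    unfolding perc_space_def by (rule measurable_component_singleton) simp
  then show ?thesis by simp
qed

lemma measurable_into_perc:
  assumes "\<And>w. (\<lambda>x. f x w) \<in> measurable M (count_space UNIV)"
  shows "f \<in> measurable M (perc_space p)"
  unfolding perc_space_def
  using assms by (intro measurable_PiM_single') (auto simp: PiE_def extensional_def)

lemma measurable_sub [measurable]: "sub w \<in> measurable (perc_space p) (perc_space p)"
  by (intro measurable_into_perc) (simp add: sub_def)

lemma pred_in_tree [measurable]: "Measurable.pred (perc_space p) (\<lambda>\<omega>. in_tree b \<omega> w)"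
  unfolding in_tree_def by measurable

lemma distr_perc_coord:
  "distr (perc_space p) (measure_pmf (bernoulli_pmf p)) (\<lambda>\<omega>. \<omega> w) = measure_pmf (bernoulli_pmf p)"
proof -
  interpret product_prob_space "\<lambda>_::('n \<Rightarrow> nat) list. measure_pmf (bernoulli_pmf p)" UNIV
    by (unfold_locales)
  show ?thesis unfolding perc_space_def using PiM_component[of w] by simp
qed

lemma indep_coords:
  "prob_space.indep_vars (perc_space p) (\<lambda>_. measure_pmf (bernoulli_pmf p))
     (\<lambda>w \<omega>. \<omega> w) (UNIV :: ('n::finite \<Rightarrow> nat) list set)"
proof -
  interpret prob_space "perc_space p :: (('n \<Rightarrow> nat) list \<Rightarrow> bool) measure"
    by (rule prob_space_perc_space)
  show ?thesis
    using measurable_perc_coord[of _ p, where 'a='n]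
    by (subst indep_vars_iff_distr_eq_PiM)
      (auto simp: distr_perc_coord[unfolded perc_space_def] perc_space_def restrict_def distr_id2)
qed

text \<open>Words with different first letters are different coordinates, so the subtrees read
  disjoint blocks of independent bits. The block of \<open>j\<close> contains the bit of
  \<open>[j]\<close> itself, which becomes the root bit of \<open>sub [j] \<omega>\<close>.\<close>

lemma indep_sub:
  "prob_space.indep_vars (perc_space p) (\<lambda>_. perc_space p) (\<lambda>j. sub [j])
     (UNIV :: ('n::finite \<Rightarrow> nat) set)"
proof -
  interpret prob_space "perc_space p :: (('n \<Rightarrow> nat) list \<Rightarrow> bool) measure"
    by (rule prob_space_perc_space)
  let ?K = "\<lambda>j::'n \<Rightarrow> nat. range (Cons j)"
  have "indep_vars (\<lambda>j. PiM (?K j) (\<lambda>_. measure_pmf (bernoulli_pmf p)))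
     (\<lambda>j \<omega>. restrict (\<lambda>i. \<omega> i) (?K j)) UNIV"
    by (rule indep_vars_restrict[OF indep_coords]) (auto simp: disjoint_family_on_def)
  then have "indep_vars (\<lambda>_. perc_space p)
     (\<lambda>j \<omega>. (\<lambda>x u. x (j # u)) (restrict (\<lambda>i. \<omega> i) (?K j))) UNIV"
  proof (rule indep_vars_compose2)
    fix j
    show "(\<lambda>x u. x (j # u)) \<in> measurable (PiM (?K j) (\<lambda>_. measure_pmf (bernoulli_pmf p))) (perc_space p)"
    proof (rule measurable_into_perc)
      fix w
      have "(\<lambda>x. x (j # w)) \<in> measurable (PiM (?K j) (\<lambda>_. measure_pmf (bernoulli_pmf p))) 
              (measure_pmf (bernoulli_pmf p))"
        by (rule measurable_component_singleton) simp
      then show "(\<lambda>x. x (j # w)) \<in> measurable (PiM (?K j) (\<lambda>_. measure_pmf (bernoulli_pmf p))) 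
              (count_space UNIV)"
        by simp
    qed
  qed
  moreover have "(\<lambda>j \<omega>. (\<lambda>x u. x (j # u)) (restrict (\<lambda>i. \<omega> i) (?K j))) = (\<lambda>j. sub [j])"
    by (auto simp: sub_def fun_eq_iff)
  ultimately show ?thesis by simp
qed

lemma distr_sub:
  "distr (perc_space p) (perc_space p) (sub w) = (perc_space p :: (('n::finite \<Rightarrow> nat) list \<Rightarrow> bool) measure)"
proof -
  have "distr (perc_space p) (PiM UNIV (\<lambda>_. measure_pmf (bernoulli_pmf p))) (\<lambda>\<omega>. \<lambda>n\<in>UNIV. \<omega> (w @ n))
     = (PiM UNIV (\<lambda>_. measure_pmf (bernoulli_pmf p)) :: (('n \<Rightarrow> nat) list \<Rightarrow> bool) measure)"
    unfolding perc_space_def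
    by (rule distr_PiM_reindex) (auto simp: inj_on_def measure_pmf.prob_space_axioms)
  then show ?thesis by (simp add: perc_space_def sub_def[abs_def] restrict_def)
qed

lemma integral_sub:
  fixes f :: "(('n::finite \<Rightarrow> nat) list \<Rightarrow> bool) \<Rightarrow> real"
  assumes "f \<in> borel_measurable (perc_space p)"
  shows "(\<integral>\<omega>. f (sub w \<omega>) \<partial>perc_space p) = (\<integral>\<omega>. f \<omega> \<partial>perc_space p)"
  using integral_distr[OF measurable_sub assms, of w] by (simp add: distr_sub)

lemma prob_sub:
  fixes P :: "(('n::finite \<Rightarrow> nat) list \<Rightarrow> bool) \<Rightarrow> bool"
  assumes [measurable]: "Measurable.pred (perc_space p) P"
  shows "measure (perc_space p) {\<omega>. P (sub w \<omega>)} = measure (perc_space p) {\<omega>. P \<omega>}"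
proof -
  have "measure (distr (perc_space p) (perc_space p) (sub w)) {\<omega>. P \<omega>}
      = measure (perc_space p) (sub w -` {\<omega>. P \<omega>} \<inter> space (perc_space p))"
    using assms by (intro measure_distr) (auto simp: pred_def)
  then show ?thesis by (simp add: distr_sub vimage_def)
qed

text \<open>The sample space also has a bit for the empty word, which \<open>in_tree\<close> never
  reads. Under the shift by \<open>[j]\<close> the bit deciding whether \<open>j\<close> is retained
  becomes this root bit, so it is independent of every \<open>rootfree\<close> event below
  \<open>j\<close>.\<close>

definition rootfree :: "(('a list \<Rightarrow> bool) \<Rightarrow> 'b) \<Rightarrow> bool" where
  "rootfree f \<longleftrightarrow> (\<forall>\<omega> c. f (fun_upd \<omega> [] c) = f \<omega>)"

lemma integral_root:
  fixes f :: "(('n::finite \<Rightarrow> nat) list \<Rightarrow> bool) \<Rightarrow> real"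
  assumes p: "0 \<le> p" "p \<le> 1" and f: "integrable (perc_space p) f" and rf: "rootfree f"
  shows "(\<integral>\<omega>. of_bool (\<omega> []) * f \<omega> \<partial>perc_space p) = p * (\<integral>\<omega>. f \<omega> \<partial>perc_space p)"
proof -
  interpret prob_space "perc_space p :: (('n \<Rightarrow> nat) list \<Rightarrow> bool) measure"
    by (rule prob_space_perc_space)
  let ?B = "measure_pmf (bernoulli_pmf p)"
  \<comment> \<open>\<open>?g\<close> refills the root coordinate with an arbitrary value, which
    turns \<open>f\<close> into a function of the other coordinates; \<open>rootfree\<close> makes
    the value irrelevant.\<close>
  let ?g = "\<lambda>x (w :: ('n \<Rightarrow> nat) list). if w = [] then True else x w"
  have [measurable]: "f \<in> borel_measurable (perc_space p)" using f by auto
  have "indep_var (PiM {[]} (\<lambda>_. ?B)) (\<lambda>\<omega>. restrict (\<lambda>i. \<omega> i) {[]})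
     (PiM (-{[]}) (\<lambda>_. ?B)) (\<lambda>\<omega>. restrict (\<lambda>i. \<omega> i) (-{[]}))"
    by (rule indep_var_restrict[OF indep_coords]) auto
  then have "indep_var borel ((\<lambda>x. of_bool (x []) :: real) \<circ> (\<lambda>\<omega>. restrict (\<lambda>i. \<omega> i) {[]}))
     borel ((\<lambda>x. f (?g x)) \<circ> (\<lambda>\<omega>. restrict (\<lambda>i. \<omega> i) (-{[]})))"
  proof (rule indep_var_compose)
    have "(\<lambda>x. x []) \<in> measurable (PiM {[]} (\<lambda>_. ?B)) ?B"
      by (rule measurable_component_singleton) simp
    then have [measurable]: "(\<lambda>x. x []) \<in> measurable (PiM {[]} (\<lambda>_. ?B)) (count_space UNIV)" by simp
    show "(\<lambda>x. of_bool (x []) :: real) \<in> borel_measurable (PiM {[]} (\<lambda>_. ?B))"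
      by measurable
    have "?g \<in> measurable (PiM (-{[]}) (\<lambda>_. ?B)) (perc_space p)"
    proof (rule measurable_into_perc)
      fix w :: "('n \<Rightarrow> nat) list"
      show "(\<lambda>x. if w = [] then True else x w) \<in> measurable (PiM (-{[]}) (\<lambda>_. ?B)) (count_space UNIV)"
      proof (cases "w = []")
        case False
        then have "(\<lambda>x. x w) \<in> measurable (PiM (-{[]}) (\<lambda>_. ?B)) ?B"
          by (intro measurable_component_singleton) simp
        with False show ?thesis by simp
      qed simp
    qed
    then show "(\<lambda>x. f (?g x)) \<in> borel_measurable (PiM (-{[]}) (\<lambda>_. ?B))"
      by measurable
  qed
  moreover have "(\<lambda>x. f (?g x)) \<circ> (\<lambda>\<omega>. restrict (\<lambda>i. \<omega> i) (-{[]})) = f"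
  proof
    fix \<omega>
    have "?g (restrict (\<lambda>i. \<omega> i) (-{[]})) = fun_upd \<omega> [] True" by auto
    then show "((\<lambda>x. f (?g x)) \<circ> (\<lambda>\<omega>. restrict (\<lambda>i. \<omega> i) (-{[]}))) \<omega> = f \<omega>"
      using rf by (simp add: rootfree_def)
  qed
  ultimately have ind: "indep_var borel (\<lambda>\<omega>. of_bool (\<omega> []) :: real) borel f"
    by (simp add: comp_def)
  have int: "integrable (perc_space p :: (('n \<Rightarrow> nat) list \<Rightarrow> bool) measure) (\<lambda>\<omega>. of_bool (\<omega> []) :: real)"
    by (rule integrable_const_bound[where B=1]) auto
  have "(\<integral>\<omega>. (of_bool (\<omega> []) :: real) \<partial>(perc_space p :: (('n \<Rightarrow> nat) list \<Rightarrow> bool) measure))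
      = (\<integral>c. of_bool c \<partial>distr (perc_space p :: (('n \<Rightarrow> nat) list \<Rightarrow> bool) measure) ?B (\<lambda>\<omega>. \<omega> []))"
    by (subst integral_distr) auto
  also have "\<dots> = p"
    using p by (simp add: distr_perc_coord)
  finally show ?thesis
    using indep_var_lebesgue_integral[OF ind int f] by simp
qed

lemma prob_root:
  fixes P :: "(('n::finite \<Rightarrow> nat) list \<Rightarrow> bool) \<Rightarrow> bool"
  assumes p: "0 \<le> p" "p \<le> 1" and [measurable]: "Measurable.pred (perc_space p) P" and rf: "rootfree P"
  shows "measure (perc_space p) {\<omega>. \<omega> [] \<and> P \<omega>} = p * measure (perc_space p) {\<omega>. P \<omega>}"
proof -
  interpret prob_space "perc_space p :: (('n \<Rightarrow> nat) list \<Rightarrow> bool) measure"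
    by (rule prob_space_perc_space)
  have eq: "(\<integral>\<omega>. of_bool (Q \<omega>) \<partial>perc_space p) = prob {\<omega>. Q \<omega>}" for Q
  proof -
    have "(\<lambda>\<omega>. of_bool (Q \<omega>) :: real) = indicator {\<omega>. Q \<omega>}" by (auto simp: indicator_def)
    then show ?thesis by simp
  qed
  have "(\<integral>\<omega>. of_bool (\<omega> []) * of_bool (P \<omega>) \<partial>perc_space p) = p * (\<integral>\<omega>. of_bool (P \<omega>) \<partial>perc_space p)"
    using rf by (intro integral_root p integrable_const_bound[where B=1]) (auto simp: rootfree_def)
  then show ?thesis by (simp add: eq flip: of_bool_conj)
qed

lemma prob_all_sub:
  fixes Q :: "('n::finite \<Rightarrow> nat) \<Rightarrow> (('n \<Rightarrow> nat) list \<Rightarrow> bool) \<Rightarrow> bool"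
  assumes [measurable]: "\<And>j. Measurable.pred (perc_space p) (Q j)" and J: "finite J"
  shows "measure (perc_space p) {\<omega>. \<forall>j\<in>J. Q j (sub [j] \<omega>)}
       = (\<Prod>j\<in>J. measure (perc_space p) {\<omega>. Q j \<omega>})"
proof (cases "J = {}")
  case True
  interpret prob_space "perc_space p :: (('n \<Rightarrow> nat) list \<Rightarrow> bool) measure"
    by (rule prob_space_perc_space)
  show ?thesis using True prob_space by simp
next
  case False
  interpret prob_space "perc_space p :: (('n \<Rightarrow> nat) list \<Rightarrow> bool) measure"
    by (rule prob_space_perc_space)
  have "prob (\<Inter>j\<in>J. sub [j] -` {\<omega>. Q j \<omega>} \<inter> space (perc_space p))
      = (\<Prod>j\<in>J. prob (sub [j] -` {\<omega>. Q j \<omega>} \<inter> space (perc_space p)))"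
    using assms False by (intro indep_varsD[OF indep_sub]) (auto simp: pred_def)
  moreover have "(\<Inter>j\<in>J. sub [j] -` {\<omega>. Q j \<omega>} \<inter> space (perc_space p)) = {\<omega>. \<forall>j\<in>J. Q j (sub [j] \<omega>)}"
    using False by auto
  moreover have "prob (sub [j] -` {\<omega>. Q j \<omega>} \<inter> space (perc_space p)) = prob {\<omega>. Q j \<omega>}" for j
    using prob_sub[where P="Q j" and w="[j]" and p=p] by (simp add: vimage_def)
  ultimately show ?thesis by simp
qed

subsection \<open>Moments of the number of descendants\<close>

definition words :: "nat \<Rightarrow> nat \<Rightarrow> ('n::finite \<Rightarrow> nat) list set" where
  "words b n = {u. set u \<subseteq> alphabet b \<and> length u = n}"

lemma finite_words [simp]: "finite (words b n)"
  unfolding words_def by (rule finite_lists_length_eq) simp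

lemma words_0 [simp]: "words b 0 = {[]}"
  by (auto simp: words_def)

lemma words_Suc: "words b (Suc n) = (\<lambda>(j, u). j # u) ` (alphabet b \<times> words b n)"
  by (auto simp: words_def length_Suc_conv image_iff)

definition num :: "nat \<Rightarrow> nat \<Rightarrow> ((('n::finite \<Rightarrow> nat) list \<Rightarrow> bool) \<Rightarrow> bool)
    \<Rightarrow> (('n \<Rightarrow> nat) list \<Rightarrow> bool) \<Rightarrow> real" where
  "num b n P \<omega> = (\<Sum>u\<in>words b n. of_bool (in_tree b \<omega> u \<and> P (sub u \<omega>)))"

lemma num_0 [simp]: "num b 0 P \<omega> = of_bool (P \<omega>)"
  by (simp add: num_def)

text \<open>Splitting at the first letter rather than the last gives summands that live on different
  subtrees and are therefore independent.\<close>

lemma num_Suc: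
  "num b (Suc n) P \<omega> = (\<Sum>j\<in>alphabet b. of_bool (\<omega> [j]) * num b n P (sub [j] \<omega>))"
proof -
  have "num b (Suc n) P \<omega> = (\<Sum>(j, u)\<in>alphabet b \<times> words b n.
      of_bool (in_tree b \<omega> (j # u) \<and> P (sub (j # u) \<omega>)))"
    unfolding num_def
    by (rule sum.reindex_cong[OF _ words_Suc]) (auto simp: inj_on_def)
  also have "\<dots> = (\<Sum>j\<in>alphabet b. \<Sum>u\<in>words b n. of_bool (in_tree b \<omega> (j # u) \<and> P (sub (j # u) \<omega>)))"
    by (rule sum.cartesian_product[symmetric])
  also have "\<dots> = (\<Sum>j\<in>alphabet b. of_bool (\<omega> [j]) * num b n P (sub [j] \<omega>))"
    unfolding num_def sum_distrib_left
    by (intro sum.cong refl) (auto simp: in_tree_Cons sub_sub)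
  finally show ?thesis .
qed

lemma num_eq_card: "num b n P \<omega> = card {u. length u = n \<and> in_tree b \<omega> u \<and> P (sub u \<omega>)}"
proof -
  have "{u. length u = n \<and> in_tree b \<omega> u \<and> P (sub u \<omega>)} = words b n \<inter> {u. in_tree b \<omega> u \<and> P (sub u \<omega>)}"
    by (auto simp: words_def in_tree_def)
  then show ?thesis by (simp add: num_def of_bool_def sum.If_cases)
qed

lemma num_nonneg: "0 \<le> num b n P \<omega>"
  by (simp add: num_eq_card)

lemma measurable_num [measurable]:
  assumes [measurable]: "Measurable.pred (perc_space p) P"
  shows "num b n P \<in> borel_measurable (perc_space p)"
  unfolding num_def by measurable

lemma num_le:
  fixes \<omega> :: "('n::finite \<Rightarrow> nat) list \<Rightarrow> bool"
  shows "num b n P \<omega> \<le> card (words b n :: ('n \<Rightarrow> nat) list set)"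
proof -
  have "num b n P \<omega> \<le> (\<Sum>u\<in>(words b n :: ('n \<Rightarrow> nat) list set). 1)"
    unfolding num_def by (rule sum_mono) simp
  then show ?thesis by simp
qed

lemma num_mono: "(\<And>\<omega>. P \<omega> \<Longrightarrow> Q \<omega>) \<Longrightarrow> num b n P \<omega> \<le> num b n Q \<omega>"
  unfolding num_def by (rule sum_mono) (auto simp: of_bool_def)

lemma sub_upd_root: "u \<noteq> [] \<Longrightarrow> sub u (fun_upd \<omega> [] c) = sub u \<omega>"
  by (auto simp: sub_def)

lemma in_tree_upd_root: "in_tree b (fun_upd \<omega> [] c) u = in_tree b \<omega> u"
  by (auto simp: in_tree_def)

lemma rootfree_num:
  assumes "rootfree P"
  shows "rootfree (num b n P)"
proof -
  have "P (sub u (fun_upd \<omega> [] c)) = P (sub u \<omega>)" for u \<omega> c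
    using assms by (cases "u = []") (auto simp: sub_upd_root rootfree_def)
  then show ?thesis
    by (simp add: rootfree_def num_def in_tree_upd_root)
qed

lemma rootfree_comp: "rootfree f \<Longrightarrow> rootfree (\<lambda>\<omega>. h (f \<omega>))"
  by (simp add: rootfree_def)

lemma integrable_num_pow:
  fixes P :: "(('n::finite \<Rightarrow> nat) list \<Rightarrow> bool) \<Rightarrow> bool"
  assumes [measurable]: "Measurable.pred (perc_space p) P"
  shows "integrable (perc_space p) (\<lambda>\<omega>. num b n P \<omega> ^ k)"
proof -
  interpret prob_space "perc_space p :: (('n \<Rightarrow> nat) list \<Rightarrow> bool) measure"
    by (rule prob_space_perc_space)
  show ?thesis
    by (rule integrable_const_bound[where B="real (card (words b n :: ('n \<Rightarrow> nat) list set)) ^ k"])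
       (auto intro!: power_mono num_le simp: num_nonneg)
qed

lemma integral_root_num_pow:
  fixes P :: "(('n::finite \<Rightarrow> nat) list \<Rightarrow> bool) \<Rightarrow> bool"
  assumes "0 \<le> p" "p \<le> 1" and [measurable]: "Measurable.pred (perc_space p) P" and "rootfree P"
  shows "(\<integral>\<omega>. of_bool (\<omega> []) * num b n P \<omega> ^ k \<partial>perc_space p) = p * (\<integral>\<omega>. num b n P \<omega> ^ k \<partial>perc_space p)"
  by (intro integral_root assms integrable_num_pow rootfree_comp[OF rootfree_num])

lemma integral_sub_num_pow:
  fixes P :: "(('n::finite \<Rightarrow> nat) list \<Rightarrow> bool) \<Rightarrow> bool"
  assumes "0 \<le> p" "p \<le> 1" and P [measurable]: "Measurable.pred (perc_space p) P" and "rootfree P"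
  shows "integrable (perc_space p) (\<lambda>\<omega>. of_bool (\<omega> [j]) * num b n P (sub [j] \<omega>) ^ k)"
    and "(\<integral>\<omega>. of_bool (\<omega> [j]) * num b n P (sub [j] \<omega>) ^ k \<partial>perc_space p)
      = p * (\<integral>\<omega>. num b n P \<omega> ^ k \<partial>perc_space p)"
proof -
  interpret prob_space "perc_space p :: (('n \<Rightarrow> nat) list \<Rightarrow> bool) measure"
    by (rule prob_space_perc_space)
  show "integrable (perc_space p) (\<lambda>\<omega>. of_bool (\<omega> [j]) * num b n P (sub [j] \<omega>) ^ k)"
    by (rule integrable_const_bound[where B="real (card (words b n :: ('n \<Rightarrow> nat) list set)) ^ k"])
       (auto intro!: power_mono num_le simp: num_nonneg)
  have "(\<integral>\<omega>. of_bool (\<omega> [j]) * num b n P (sub [j] \<omega>) ^ k \<partial>perc_space p)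
      = (\<integral>\<omega>. (\<lambda>\<omega>. of_bool (\<omega> []) * num b n P \<omega> ^ k) (sub [j] \<omega>) \<partial>perc_space p)"
    by (simp add: sub_apply)
  also have "\<dots> = (\<integral>\<omega>. of_bool (\<omega> []) * num b n P \<omega> ^ k \<partial>perc_space p)"
    by (rule integral_sub) measurable
  finally show "(\<integral>\<omega>. of_bool (\<omega> [j]) * num b n P (sub [j] \<omega>) ^ k \<partial>perc_space p)
      = p * (\<integral>\<omega>. num b n P \<omega> ^ k \<partial>perc_space p)"
    by (simp add: integral_root_num_pow[OF assms])
qed

lemma expectation_num:
  fixes P :: "(('n::finite \<Rightarrow> nat) list \<Rightarrow> bool) \<Rightarrow> bool"
  assumes "0 \<le> p" "p \<le> 1" and P [measurable]: "Measurable.pred (perc_space p) P" and "rootfree P"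
  shows "(\<integral>\<omega>. num b n P \<omega> \<partial>perc_space p)
    = (p * real b ^ CARD('n)) ^ n * measure (perc_space p) {\<omega>. P \<omega>}"
proof (induction n)
  case 0
  have "(\<lambda>\<omega>. of_bool (P \<omega>) :: real) = indicator {\<omega>. P \<omega>}" by (auto simp: indicator_def)
  then show ?case by simp
next
  case (Suc n)
  have "(\<integral>\<omega>. num b (Suc n) P \<omega> \<partial>perc_space p)
      = (\<Sum>j\<in>alphabet b. \<integral>\<omega>. of_bool (\<omega> [j]) * num b n P (sub [j] \<omega>) \<partial>perc_space p)"
    unfolding num_Suc
    by (rule Bochner_Integration.integral_sum) (use integral_sub_num_pow(1)[OF assms, where k=1] in simp)
  also have "\<dots> = real b ^ CARD('n) * (p * (\<integral>\<omega>. num b n P \<omega> \<partial>perc_space p))"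
    using integral_sub_num_pow(2)[OF assms, where k=1] by (simp add: card_alphabet)
  finally show ?case by (simp add: Suc.IH algebra_simps)
qed

text \<open>By \<open>num_Suc\<close> the count is a sum of \<open>b^d\<close> independent copies of
  one variable: pairs of different letters contribute products of means, and only the diagonal keeps
  a second moment.\<close>

lemma second_moment_num_Suc:
  fixes P :: "(('n::finite \<Rightarrow> nat) list \<Rightarrow> bool) \<Rightarrow> bool"
  assumes "0 \<le> p" "p \<le> 1" and P [measurable]: "Measurable.pred (perc_space p) P" and "rootfree P"
  shows "(\<integral>\<omega>. num b (Suc n) P \<omega> ^ 2 \<partial>perc_space p)
    \<le> (\<integral>\<omega>. num b (Suc n) P \<omega> \<partial>perc_space p) ^ 2
      + p * real b ^ CARD('n) * (\<integral>\<omega>. num b n P \<omega> ^ 2 \<partial>perc_space p)"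
proof -
  interpret prob_space "perc_space p :: (('n \<Rightarrow> nat) list \<Rightarrow> bool) measure"
    by (rule prob_space_perc_space)
  define Y where "Y j \<omega> = of_bool (\<omega> [j]) * num b n P (sub [j] \<omega>)" for j \<omega>
  let ?A = "alphabet b :: ('n \<Rightarrow> nat) set"
  let ?e = "expectation (num b n P)" and ?s = "expectation (\<lambda>\<omega>. num b n P \<omega> ^ 2)"
  have intY: "integrable (perc_space p) (Y j)" and EY: "expectation (Y j) = p * ?e" for j
    using integral_sub_num_pow[OF assms, where k=1, of j b n] by (simp_all add: Y_def[abs_def])
  have indY: "indep_vars (\<lambda>_. borel) (\<lambda>j \<omega>. (\<lambda>\<omega>. of_bool (\<omega> []) * num b n P \<omega>) (sub [j] \<omega>)) UNIV"
    by (rule indep_vars_compose2[OF indep_sub]) measurable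
  then have indY: "indep_vars (\<lambda>_. borel) Y UNIV"
    by (simp add: Y_def[abs_def] sub_apply)
  have int2: "integrable (perc_space p) (\<lambda>\<omega>. Y i \<omega> * Y j \<omega>)" for i j
  proof (rule integrable_const_bound)
    let ?c = "real (card (words b n :: ('n \<Rightarrow> nat) list set))"
    have "\<bar>Y k \<omega>\<bar> \<le> ?c" for k \<omega>
      using num_nonneg[of b n P "sub [k] \<omega>"] num_le[of b n P "sub [k] \<omega>"] by (simp add: Y_def of_bool_def)
    then show "AE \<omega> in perc_space p. norm (Y i \<omega> * Y j \<omega>) \<le> ?c * ?c"
      by (intro AE_I2) (auto simp: abs_mult intro!: mult_mono)
    show "(\<lambda>\<omega>. Y i \<omega> * Y j \<omega>) \<in> borel_measurable (perc_space p)"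
      unfolding Y_def by measurable
  qed
  have cross: "expectation (\<lambda>\<omega>. Y i \<omega> * Y j \<omega>) = (p * ?e) * (p * ?e)" if "i \<noteq> j" for i j
  proof -
    have "expectation (\<lambda>\<omega>. \<Prod>k\<in>{i, j}. Y k \<omega>) = (\<Prod>k\<in>{i, j}. expectation (Y k))"
      by (rule indep_vars_lebesgue_integral[OF _ indep_vars_subset[OF indY] intY]) auto
    then show ?thesis using EY that by simp
  qed
  have diag: "expectation (\<lambda>\<omega>. Y j \<omega> * Y j \<omega>) = p * ?s" for j
  proof -
    have "Y j \<omega> * Y j \<omega> = of_bool (\<omega> [j]) * num b n P (sub [j] \<omega>) ^ 2" for \<omega>
      by (simp add: Y_def power2_eq_square)
    then show ?thesis using integral_sub_num_pow(2)[OF assms, where k=2, of j b n] by simp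
  qed
  have "expectation (\<lambda>\<omega>. num b (Suc n) P \<omega> ^ 2) = expectation (\<lambda>\<omega>. \<Sum>i\<in>?A. \<Sum>j\<in>?A. Y i \<omega> * Y j \<omega>)"
    by (simp only: num_Suc Y_def power2_eq_square sum_product)
  also have "\<dots> = (\<Sum>i\<in>?A. \<Sum>j\<in>?A. expectation (\<lambda>\<omega>. Y i \<omega> * Y j \<omega>))"
    by (simp add: Bochner_Integration.integral_sum int2)
  \<comment> \<open>The product of means is added on the diagonal as well, where it only enlarges
    the bound, so that the double sum becomes the full square of the mean.\<close>
  also have "\<dots> \<le> (\<Sum>i\<in>?A. \<Sum>j\<in>?A. (p * ?e) * (p * ?e) + (if i = j then p * ?s else 0))"
  proof (intro sum_mono)
    fix i j
    have "0 \<le> (p * ?e) * (p * ?e)" by simp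
    then show "expectation (\<lambda>\<omega>. Y i \<omega> * Y j \<omega>) \<le> (p * ?e) * (p * ?e) + (if i = j then p * ?s else 0)"
      using cross[of i j] diag[of j] by auto
  qed
  also have "\<dots> = (real b ^ CARD('n) * (p * ?e))\<^sup>2 + p * real b ^ CARD('n) * ?s"
    by (simp add: sum.distrib card_alphabet power2_eq_square algebra_simps)
  also have "real b ^ CARD('n) * (p * ?e) = expectation (num b (Suc n) P)"
    using expectation_num[OF assms, of b n] expectation_num[OF assms, of b "Suc n"] by simp
  finally show ?thesis .
qed

text \<open>Solves the recursion \<open>s (n+1) \<le> (m^(n+1) q)^2 + m * s n\<close> with
  \<open>s 0 = q\<close>. After division by \<open>m^(2n)\<close>, the constant
  \<open>m / (m - 1)\<close> is the fixed point of \<open>x \<mapsto> 1 + x / m\<close>, and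
  \<open>q / m^n\<close> is what remains of the initial value.\<close>

lemma second_moment_num:
  fixes P :: "(('n::finite \<Rightarrow> nat) list \<Rightarrow> bool) \<Rightarrow> bool"
  assumes p: "0 \<le> p" "p \<le> 1" and P [measurable]: "Measurable.pred (perc_space p) P" and rf: "rootfree P"
    and m: "m = p * real b ^ CARD('n)" "m > 1" and q: "q = measure (perc_space p) {\<omega>. P \<omega>}"
  shows "(\<integral>\<omega>. num b n P \<omega> ^ 2 \<partial>perc_space p) \<le> m ^ (2 * n) * (q\<^sup>2 * (m / (m - 1)) + q / m ^ n)"
proof (induction n)
  case 0
  have "(\<lambda>\<omega>. of_bool (P \<omega>) ^ 2 :: real) = indicator {\<omega>. P \<omega>}" by (auto simp: indicator_def)
  then show ?case using m q by simp
next
  case (Suc n)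
  have "(\<integral>\<omega>. num b (Suc n) P \<omega> ^ 2 \<partial>perc_space p)
    \<le> (m ^ Suc n * q)\<^sup>2 + m * (\<integral>\<omega>. num b n P \<omega> ^ 2 \<partial>perc_space p)"
    using second_moment_num_Suc[OF p P rf, of b n] expectation_num[OF p P rf, of b "Suc n"]
    by (simp add: m q)
  also have "\<dots> \<le> (m ^ Suc n * q)\<^sup>2 + m * (m ^ (2 * n) * (q\<^sup>2 * (m / (m - 1)) + q / m ^ n))"
    using Suc.IH m by (intro add_left_mono mult_left_mono) auto
  also have "\<dots> = m ^ (2 * Suc n) * (q\<^sup>2 * (m / (m - 1)) + q / m ^ Suc n)"
  proof -
    have sq: "m ^ n * m ^ n = m ^ (n * 2)" by (metis mult_2_right power_add)
    have "(m ^ Suc n * q)\<^sup>2 = m ^ (2 * Suc n) * q\<^sup>2"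
      using sq by (simp add: power2_eq_square mult_ac)
    moreover have "m * (m ^ (2 * n) * (q\<^sup>2 * (m / (m - 1)) + q / m ^ n))
       = m ^ (2 * Suc n) * (q\<^sup>2 * (1 / (m - 1)) + q / m ^ Suc n)"
      using m(2) sq by (simp add: field_simps)
    moreover have "m / (m - 1) = 1 + 1 / (m - 1)" using m(2) by (simp add: field_simps)
    ultimately show ?thesis by (simp only: distrib_left distrib_right)
  qed
  finally show ?case .
qed

text \<open>In place of Cauchy-Schwarz the proof uses a pointwise bound: off the event
  \<open>X\<close> is below \<open>e / 2\<close>, and on it
  \<open>X \<le> t * X^2 + 1 / (4 * t)\<close> by completing a square.\<close>

lemma (in prob_space) paley_zygmund:
  fixes X :: "'a \<Rightarrow> real"
  assumes X: "integrable M X" and X2: "integrable M (\<lambda>x. X x ^ 2)"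
    and e: "e = expectation X" "e > 0" and s: "expectation (\<lambda>x. X x ^ 2) \<le> s" "s > 0"
  shows "e\<^sup>2 / (4 * s) \<le> prob {x \<in> space M. e / 2 \<le> X x}"
proof -
  have [measurable]: "X \<in> borel_measurable M" using X by auto
  define A where "A = {x \<in> space M. e / 2 \<le> X x}"
  have A [measurable]: "A \<in> events" unfolding A_def by measurable
  \<comment> \<open>This \<open>t\<close> makes \<open>t * s = e / 4\<close>, which leaves a quarter
    of the mean for the event.\<close>
  define t where "t = e / (4 * s)"
  have t: "t > 0" using e s by (simp add: t_def)
  have iA: "integrable M (indicator A :: 'a \<Rightarrow> real)"
    by (rule integrable_real_indicator) (auto simp: less_top[symmetric])
  have "X x \<le> e / 2 + (t * X x ^ 2 + indicator A x / (4 * t))" if "x \<in> space M" for x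
  proof (cases "x \<in> A")
    case True
    have "0 \<le> (2 * t * X x - 1)\<^sup>2 / (4 * t)" using t by simp
    also have "\<dots> = t * X x ^ 2 - X x + 1 / (4 * t)"
      using t by (simp add: power2_eq_square algebra_simps add_divide_distrib diff_divide_distrib)
    finally show ?thesis using True e by simp
  next
    case False
    then have "X x < e / 2" using that by (simp add: A_def)
    moreover have "0 \<le> t * X x ^ 2" using t by simp
    ultimately show ?thesis using False by simp
  qed
  then have "expectation X \<le> expectation (\<lambda>x. e / 2 + (t * X x ^ 2 + indicator A x / (4 * t)))"
    using X X2 iA by (intro integral_mono) auto
  also have "\<dots> = e / 2 + (t * expectation (\<lambda>x. X x ^ 2) + prob A / (4 * t))"
    using X X2 A iA sets.sets_into_space[OF A] by (simp add: prob_space Int_absorb2)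
  also have "\<dots> \<le> e / 2 + (t * s + prob A / (4 * t))"
    using s t by simp
  finally have "e \<le> e / 2 + (t * s + prob A / (4 * t))" using e by simp
  moreover have "t * s = e / 4" using s by (simp add: t_def)
  ultimately have "e / 4 \<le> prob A / (4 * t)" by simp
  then have "e * t \<le> prob A" using t by (simp add: field_simps)
  then show ?thesis by (simp add: A_def t_def power2_eq_square)
qed

subsection \<open>Regular subtrees\<close>

text \<open>The assumption \<open>q * m ^ n \<ge> 1\<close> turns the term \<open>q / m ^ n\<close>
  of the second moment into at most \<open>q^2\<close>. Second moment and squared mean are then
  comparable, and \<open>q\<close> and \<open>n\<close> cancel from the quotient.\<close>

lemma prob_many_descendants:
  fixes P :: "(('n::finite \<Rightarrow> nat) list \<Rightarrow> bool) \<Rightarrow> bool"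
  assumes p: "0 \<le> p" "p \<le> 1" and P [measurable]: "Measurable.pred (perc_space p) P" and rf: "rootfree P"
    and m: "m = p * real b ^ CARD('n)" "m > 1" and q: "q = measure (perc_space p) {\<omega>. P \<omega>}"
    and large: "q * m ^ n \<ge> 1"
  shows "1 / (4 * (m / (m - 1) + 1)) \<le> measure (perc_space p) {\<omega>. q * m ^ n / 2 \<le> num b n P \<omega>}"
proof -
  interpret prob_space "perc_space p :: (('n \<Rightarrow> nat) list \<Rightarrow> bool) measure"
    by (rule prob_space_perc_space)
  have mn: "m ^ n > 0" using m by simp
  have q0: "q > 0" using large mn by (smt (verit) mult_nonpos_nonneg)
  have C: "m / (m - 1) + 1 > 0" using m by (simp add: add_pos_pos)
  have "q / m ^ n \<le> q\<^sup>2"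
    using large q0 mn by (simp add: divide_simps power2_eq_square)
  then have "m ^ (2 * n) * (q\<^sup>2 * (m / (m - 1)) + q / m ^ n) \<le> m ^ (2 * n) * (q\<^sup>2 * (m / (m - 1)) + q\<^sup>2)"
    using m by (intro mult_left_mono) auto
  also have "\<dots> = (q * m ^ n)\<^sup>2 * (m / (m - 1) + 1)"
    by (simp add: power_mult_distrib power_mult[symmetric] mult.commute[of n 2] distrib_left)
  finally have s: "expectation (\<lambda>\<omega>. num b n P \<omega> ^ 2) \<le> (q * m ^ n)\<^sup>2 * (m / (m - 1) + 1)"
    using second_moment_num[OF p P rf m q, of n] by linarith
  have e: "expectation (num b n P) = q * m ^ n"
    using expectation_num[OF p P rf, of b n] by (simp add: m q)
  have "(q * m ^ n)\<^sup>2 / (4 * ((q * m ^ n)\<^sup>2 * (m / (m - 1) + 1))) 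
      \<le> prob {\<omega> \<in> space (perc_space p). q * m ^ n / 2 \<le> num b n P \<omega>}"
  proof (rule paley_zygmund)
    show "integrable (perc_space p) (num b n P)" using integrable_num_pow[OF P, where k=1, of b n] by simp
    show "integrable (perc_space p) (\<lambda>\<omega>. num b n P \<omega> ^ 2)" by (rule integrable_num_pow[OF P])
    show "q * m ^ n = expectation (num b n P)" by (simp add: e)
    show "q * m ^ n > 0" using q0 mn by simp
    show "(q * m ^ n)\<^sup>2 * (m / (m - 1) + 1) > 0" by (rule mult_pos_pos[OF zero_less_power[OF mult_pos_pos[OF q0 mn]] C])
  qed (rule s)
  moreover have "x\<^sup>2 / (4 * (x\<^sup>2 * C)) = 1 / (4 * C)" if "x > 0" for x C :: real
    using that by simp
  note this[OF mult_pos_pos[OF q0 mn], of "m / (m - 1) + 1"]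
  ultimately show ?thesis by simp
qed

text \<open>One level is a block of \<open>n + 2\<close> letters: a forced \<open>j j\<close> for
  every letter \<open>j\<close>, then \<open>n\<close> free generations. Asking for at least
  \<open>K\<close> descendants keeps the condition monotone; exactly \<open>K\<close> are selected
  only once the subtree is infinite.\<close>

primrec good :: "nat \<Rightarrow> nat \<Rightarrow> nat \<Rightarrow> nat \<Rightarrow> (('n::finite \<Rightarrow> nat) list \<Rightarrow> bool) \<Rightarrow> bool" where
  "good b n K 0 = (\<lambda>\<omega>. True)"
| "good b n K (Suc k) = (\<lambda>\<omega>. \<forall>j\<in>alphabet b. \<omega> [j] \<and> \<omega> [j, j] \<and>
     real K \<le> num b n (good b n K k) (sub [j, j] \<omega>))"

definition good_inf :: "nat \<Rightarrow> nat \<Rightarrow> nat \<Rightarrow> (('n::finite \<Rightarrow> nat) list \<Rightarrow> bool) \<Rightarrow> bool" where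
  "good_inf b n K \<omega> \<longleftrightarrow> (\<forall>k. good b n K k \<omega>)"

lemma measurable_good [measurable]: "Measurable.pred (perc_space p) (good b n K k)"
proof (induction k)
  case (Suc k)
  note Suc [measurable]
  show ?case by simp
qed simp

lemma measurable_good_inf [measurable]: "Measurable.pred (perc_space p) (good_inf b n K)"
  unfolding good_inf_def[abs_def] by measurable

lemma rootfree_good: "rootfree (good b n K k)"
  by (cases k) (auto simp: rootfree_def sub_upd_root)

lemma good_Suc_imp: "good b n K (Suc k) \<omega> \<Longrightarrow> good b n K k \<omega>"
proof (induction k arbitrary: \<omega>)
  case (Suc k)
  have "num b n (good b n K (Suc k)) \<omega>' \<le> num b n (good b n K k) \<omega>'" for \<omega>' :: "('a \<Rightarrow> nat) list \<Rightarrow> bool"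
    by (rule num_mono) (rule Suc.IH)
  then show ?case using Suc.prems by (simp only: good.simps) (meson order_trans)
qed simp

lemma prob_doubled_letters:
  fixes P :: "(('n::finite \<Rightarrow> nat) list \<Rightarrow> bool) \<Rightarrow> bool"
  assumes p: "0 \<le> p" "p \<le> 1" and P [measurable]: "Measurable.pred (perc_space p) P" and rf: "rootfree P"
  shows "measure (perc_space p) {\<omega>. \<forall>j\<in>alphabet b. \<omega> [j] \<and> \<omega> [j, j] \<and> P (sub [j, j] \<omega>)}
    = (p\<^sup>2 * measure (perc_space p) {\<omega>. P \<omega>}) ^ (b ^ CARD('n))"
proof -
  \<comment> \<open>\<open>Q j\<close> is the condition seen from the vertex \<open>[j]\<close>,
    whose own bit is the root bit. The second \<open>j\<close> is treated the same way one
    generation further down, which yields \<open>p^2\<close>.\<close>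
  define Q where "Q j \<omega> \<longleftrightarrow> \<omega> [] \<and> \<omega> [j] \<and> P (sub [j] \<omega>)" for j \<omega>
  have [measurable]: "Measurable.pred (perc_space p) (Q j)" for j unfolding Q_def by measurable
  have Q: "measure (perc_space p) {\<omega>. Q j \<omega>} = p\<^sup>2 * measure (perc_space p) {\<omega>. P \<omega>}" for j
  proof -
    have "measure (perc_space p) {\<omega>. Q j \<omega>} = p * measure (perc_space p) {\<omega>. \<omega> [j] \<and> P (sub [j] \<omega>)}"
      unfolding Q_def by (rule prob_root[OF p]) (measurable, simp add: rootfree_def sub_upd_root)
    also have "measure (perc_space p) {\<omega>. \<omega> [j] \<and> P (sub [j] \<omega>)} = measure (perc_space p) {\<omega>. \<omega> [] \<and> P \<omega>}"
      using prob_sub[where P="\<lambda>\<omega>. \<omega> [] \<and> P \<omega>" and w="[j]" and p=p] by (simp add: sub_apply)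
    also have "\<dots> = p * measure (perc_space p) {\<omega>. P \<omega>}"
      by (rule prob_root[OF p P rf])
    finally show ?thesis by (simp add: power2_eq_square)
  qed
  have "{\<omega>. \<forall>j\<in>alphabet b. \<omega> [j] \<and> \<omega> [j, j] \<and> P (sub [j, j] \<omega>)} = {\<omega>. \<forall>j\<in>alphabet b. Q j (sub [j] \<omega>)}"
    by (simp add: Q_def sub_apply sub_sub)
  then show ?thesis
    by (simp add: prob_all_sub Q card_alphabet)
qed

text \<open>\<open>q\<close> is exactly what one step of the recursion returns, whatever the
  probability at the previous level is, as long as it is at least \<open>q\<close>. The bound
  therefore reproduces itself along the induction.\<close>

lemma prob_good_ge:
  fixes p :: real and b n K k :: nat
  assumes p: "0 \<le> p" "p \<le> 1" 
    and m: "m = p * real b ^ CARD('n::finite)" "m > 1" 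
    and q: "q = (p\<^sup>2 * (1 / (4 * (m / (m - 1) + 1)))) ^ (b ^ CARD('n))"
    and large: "q * m ^ n \<ge> 1" and K: "real K \<le> q * m ^ n / 2"
  shows "q \<le> measure (perc_space p) {\<omega> :: ('n \<Rightarrow> nat) list \<Rightarrow> bool. good b n K k \<omega>}"
proof (induction k)
  interpret prob_space "perc_space p :: (('n \<Rightarrow> nat) list \<Rightarrow> bool) measure"
    by (rule prob_space_perc_space)
  define c where "c = 1 / (4 * (m / (m - 1) + 1))"
  have c: "0 \<le> c" "c \<le> 1"
    using m by (auto simp: c_def divide_simps)
  have p2: "p\<^sup>2 \<le> 1" using p by (simp add: power_le_one)
  {
    case 0
    have "q \<le> 1"
      unfolding q c_def[symmetric] using p2 p c by (intro power_le_one) (auto intro: mult_le_one)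
    then show ?case using prob_space by simp
  next
    case (Suc k)
    let ?P = "good b n K k :: (('n \<Rightarrow> nat) list \<Rightarrow> bool) \<Rightarrow> bool"
    let ?q = "prob {\<omega>. ?P \<omega>}"
    have mn: "m ^ n > 0" using m by simp
    \<comment> \<open>The second moment bound is stated with the true probability \<open>?q\<close>;
      \<open>q \<le> ?q\<close> carries both the largeness condition and the bound on
      \<open>K\<close> over to it.\<close>
    have le: "q * m ^ n \<le> ?q * m ^ n" using Suc.IH mn by simp
    have "c \<le> prob {\<omega>. ?q * m ^ n / 2 \<le> num b n ?P \<omega>}"
      unfolding c_def
      by (rule prob_many_descendants[OF p measurable_good rootfree_good m refl]) (use large le in linarith)
    also have "\<dots> \<le> prob {\<omega>. real K \<le> num b n ?P \<omega>}"
    proof (rule finite_measure_mono)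
      show "{\<omega>. ?q * m ^ n / 2 \<le> num b n ?P \<omega>} \<subseteq> {\<omega>. real K \<le> num b n ?P \<omega>}"
        using K le by auto
      have "Measurable.pred (perc_space p) (\<lambda>\<omega>. real K \<le> num b n ?P \<omega>)" by measurable
      then show "{\<omega>. real K \<le> num b n ?P \<omega>} \<in> events" by (simp add: pred_def)
    qed
    finally have "p\<^sup>2 * c \<le> p\<^sup>2 * prob {\<omega>. real K \<le> num b n ?P \<omega>}"
      by (rule mult_left_mono) simp
    then have "q \<le> (p\<^sup>2 * prob {\<omega>. real K \<le> num b n ?P \<omega>}) ^ (b ^ CARD('n))"
      unfolding q c_def[symmetric] using c by (intro power_mono) auto
    also have "\<dots> = prob {\<omega>. good b n K (Suc k) \<omega>}"
      unfolding good.simps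
      by (rule prob_doubled_letters[OF p, symmetric])
         (measurable, rule rootfree_comp[OF rootfree_num[OF rootfree_good]])
    finally show ?case .
  }
qed

lemma prob_good_inf_ge:
  fixes p :: real and b n K :: nat
  assumes "\<And>k. q \<le> measure (perc_space p) {\<omega> :: ('n::finite \<Rightarrow> nat) list \<Rightarrow> bool. good b n K k \<omega>}"
  shows "q \<le> measure (perc_space p) {\<omega> :: ('n \<Rightarrow> nat) list \<Rightarrow> bool. good_inf b n K \<omega>}"
proof -
  interpret prob_space "perc_space p :: (('n \<Rightarrow> nat) list \<Rightarrow> bool) measure"
    by (rule prob_space_perc_space)
  let ?A = "\<lambda>k. {\<omega> :: ('n \<Rightarrow> nat) list \<Rightarrow> bool. good b n K k \<omega>}"
  have "(\<lambda>k. prob (?A k)) \<longlonglongrightarrow> prob (\<Inter>k. ?A k)"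
  proof (rule finite_Lim_measure_decseq)
    show "range ?A \<subseteq> events"
      using measurable_good[where p=p] by (auto simp: pred_def)
    show "decseq ?A"
      by (intro decseq_SucI) (auto simp del: good.simps dest: good_Suc_imp)
  qed
  then have "q \<le> prob (\<Inter>k. ?A k)"
    using assms by (intro LIMSEQ_le_const) auto
  also have "(\<Inter>k. ?A k) = {\<omega>. good_inf b n K \<omega>}" by (auto simp: good_inf_def)
  finally show ?thesis .
qed

text \<open>The descendants that witness depth \<open>k\<close> may change with \<open>k\<close>.
  But only finitely many words are counted, and for each of them the condition, decreasing in
  \<open>k\<close>, is eventually constant; so the counts converge and the bound \<open>K\<close>
  survives in the limit.\<close>

lemma good_infD:
  assumes good: "good_inf b n K \<omega>" and j: "j \<in> alphabet b"
  shows "\<omega> [j]" "\<omega> [j, j]" "real K \<le> num b n (good_inf b n K) (sub [j, j] \<omega>)"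
proof -
  have Suc: "good b n K (Suc k) \<omega>" for k using good by (simp add: good_inf_def del: good.simps)
  show "\<omega> [j]" "\<omega> [j, j]" using Suc[of 0] j by auto
  let ?\<omega> = "sub [j, j] \<omega>"
  have "(\<lambda>k. num b n (good b n K k) ?\<omega>) \<longlonglongrightarrow> num b n (good_inf b n K) ?\<omega>"
    unfolding num_def
  proof (intro tendsto_sum tendsto_eventually)
    fix u :: "('a \<Rightarrow> nat) list"
    let ?\<nu> = "sub u ?\<omega>"
    have "\<forall>\<^sub>F k in sequentially. good b n K k ?\<nu> = good_inf b n K ?\<nu>"
    proof (cases "good_inf b n K ?\<nu>")
      case False
      then obtain k where k: "\<not> good b n K k ?\<nu>" by (auto simp: good_inf_def)
      have "\<not> good b n K l ?\<nu>" if "l \<ge> k" for l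
        using that by (induction l rule: dec_induct) (use k good_Suc_imp in blast)+
      with False show ?thesis by (auto simp: eventually_sequentially)
    qed (auto simp: good_inf_def)
    then show "\<forall>\<^sub>F k in sequentially. of_bool (in_tree b ?\<omega> u \<and> good b n K k ?\<nu>)
       = (of_bool (in_tree b ?\<omega> u \<and> good_inf b n K ?\<nu>) :: real)"
      by eventually_elim simp
  qed
  moreover have "real K \<le> num b n (good b n K k) ?\<omega>" for k
    using Suc[of k] j by simp
  ultimately show "real K \<le> num b n (good_inf b n K) ?\<omega>"
    by (intro LIMSEQ_le_const) auto
qed

section \<open>Survival and the almost sure existence of regular subtrees\<close>

lemma in_tree_take: "in_tree b \<omega> w \<Longrightarrow> in_tree b \<omega> (take k w)"
  using in_tree_append[of b \<omega> "take k w" "drop k w"] by simp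

text \<open>Following the single letter zero at the start of each block already shows survival, so
  extinct trees contain no regular subtree. Blocks overshoot the prescribed length, hence an
  inequality.\<close>

lemma good_inf_imp_deep:
  assumes "good_inf b n K \<omega>" "K > 0" "b > 0"
  shows "\<exists>w. length w \<ge> k \<and> in_tree b \<omega> w"
  using assms(1)
proof (induction k arbitrary: \<omega>)
  case 0
  then show ?case by (intro exI[of _ "[]"]) simp
next
  case (Suc k)
  define j :: "'a \<Rightarrow> nat" where "j = (\<lambda>_. 0)"
  have j: "j \<in> alphabet b" using assms by (simp add: alphabet_def j_def)
  note g = good_infD[OF Suc.prems j]
  have "num b n (good_inf b n K) (sub [j, j] \<omega>) \<noteq> 0" using g(3) assms(2) by auto
  then obtain u where u: "in_tree b (sub [j, j] \<omega>) u" "good_inf b n K (sub u (sub [j, j] \<omega>))"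
    unfolding num_def by (auto simp: sum_nonneg_eq_0_iff)
  from Suc.IH[OF u(2)] obtain w where w: "length w \<ge> k" "in_tree b (sub u (sub [j, j] \<omega>)) w" by auto
  have "in_tree b \<omega> ([j, j] @ u @ w)"
    using g(1,2) j u w by (simp add: in_tree_Cons in_tree_append sub_sub sub_apply)
  then show ?case using w by (intro exI[of _ "[j, j] @ u @ w"]) auto
qed

lemma nonextinct_iff: "nonextinct b \<omega> \<longleftrightarrow> (\<exists>j\<in>alphabet b. \<omega> [j] \<and> nonextinct b (sub [j] \<omega>))"
  for \<omega> :: "('n::finite \<Rightarrow> nat) list \<Rightarrow> bool"
proof
  assume L: "nonextinct b \<omega>"
  show "\<exists>j\<in>alphabet b. \<omega> [j] \<and> nonextinct b (sub [j] \<omega>)"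
  proof (rule ccontr)
    assume "\<not> ?thesis"
    then have "\<forall>j\<in>alphabet b. \<omega> [j] \<longrightarrow> (\<exists>n. \<forall>w. length w = n \<longrightarrow> \<not> in_tree b (sub [j] \<omega>) w)"
      by (auto simp: nonextinct_def)
    then obtain N where N: "\<And>j w. j \<in> alphabet b \<Longrightarrow> \<omega> [j] \<Longrightarrow> length w = N j \<Longrightarrow> \<not> in_tree b (sub [j] \<omega>) w"
      by metis
    \<comment> \<open>Finite branching: the sum over all letters bounds every extinction generation
      \<open>N j\<close> at once, so a word of length \<open>Suc m\<close> would outlive the subtree
      below its first letter.\<close>
    define m where "m = (\<Sum>j\<in>alphabet b. N j)"
    obtain w where w: "length w = Suc m" "in_tree b \<omega> w" using L unfolding nonextinct_def by blast
    then obtain j u where ju: "w = j # u" "length u = m" by (auto simp: length_Suc_conv)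
    with w have j: "j \<in> alphabet b" "\<omega> [j]" and u: "in_tree b (sub [j] \<omega>) u" by (auto simp: in_tree_Cons)
    have "N j \<le> m" unfolding m_def using j by (intro member_le_sum) auto
    then have "length (take (N j) u) = N j" using ju by simp
    then show False using N[OF j] in_tree_take[OF u] by blast
  qed
next
  assume "\<exists>j\<in>alphabet b. \<omega> [j] \<and> nonextinct b (sub [j] \<omega>)"
  then obtain j where j: "j \<in> alphabet b" "\<omega> [j]" "nonextinct b (sub [j] \<omega>)" by blast
  show "nonextinct b \<omega>"
    unfolding nonextinct_def
  proof
    fix n
    obtain w where "length w = n" "in_tree b (sub [j] \<omega>) w" using j unfolding nonextinct_def by blast
    then have "in_tree b \<omega> (take n (j # w))" using j by (intro in_tree_take) (simp add: in_tree_Cons)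
    then show "\<exists>w. length w = n \<and> in_tree b \<omega> w" using \<open>length w = n\<close> by (intro exI[of _ "take n (j # w)"]) simp
  qed
qed

lemma measurable_nonextinct [measurable]: "Measurable.pred (perc_space p) (nonextinct b)"
  unfolding nonextinct_def[abs_def] by measurable

lemma rootfree_nonextinct: "rootfree (nonextinct b)"
  by (simp add: rootfree_def nonextinct_def in_tree_upd_root)

text \<open>The right-hand side is the generating function of the number of retained children, a
  binomial variable with \<open>b^d\<close> trials, evaluated at the probability of
  \<open>P\<close>.\<close>

lemma prob_all_children:
  fixes P :: "(('n::finite \<Rightarrow> nat) list \<Rightarrow> bool) \<Rightarrow> bool"
  assumes p: "0 \<le> p" "p \<le> 1" and P [measurable]: "Measurable.pred (perc_space p) P" and rf: "rootfree P"
  shows "measure (perc_space p) {\<omega>. \<forall>j\<in>alphabet b. \<omega> [j] \<longrightarrow> P (sub [j] \<omega>)}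
    = (1 - p + p * measure (perc_space p) {\<omega>. P \<omega>}) ^ (b ^ CARD('n))"
proof -
  interpret prob_space "perc_space p :: (('n \<Rightarrow> nat) list \<Rightarrow> bool) measure"
    by (rule prob_space_perc_space)
  have ev: "{\<omega>. Q \<omega>} \<in> events" if "Measurable.pred (perc_space p) Q" for Q
    using that by (simp add: pred_def)
  have "prob {\<omega>. \<omega> [] \<and> \<not> P \<omega>} = p * prob {\<omega>. \<not> P \<omega>}"
    using rf by (intro prob_root p) (auto simp: rootfree_def)
  also have "prob {\<omega>. \<not> P \<omega>} = 1 - prob {\<omega>. P \<omega>}"
    using prob_compl[OF ev[OF P]] by (simp add: Compl_eq_Diff_UNIV[symmetric] Collect_neg_eq)
  also have "prob {\<omega>. \<omega> [] \<and> \<not> P \<omega>} = 1 - prob {\<omega>. \<omega> [] \<longrightarrow> P \<omega>}"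
  proof -
    have "{\<omega>. \<omega> [] \<longrightarrow> P \<omega>} \<in> events" by (rule ev) measurable
    from prob_compl[OF this] show ?thesis by (simp add: Compl_eq_Diff_UNIV[symmetric] Collect_neg_eq[symmetric])
  qed
  finally have *: "prob {\<omega>. \<omega> [] \<longrightarrow> P \<omega>} = 1 - p + p * prob {\<omega>. P \<omega>}" by (simp add: algebra_simps)
  have "prob {\<omega>. \<forall>j\<in>alphabet b. (\<lambda>\<omega>. \<omega> [] \<longrightarrow> P \<omega>) (sub [j] \<omega>)}
    = (\<Prod>j\<in>(alphabet b :: ('n \<Rightarrow> nat) set). prob {\<omega>. \<omega> [] \<longrightarrow> P \<omega>})"
    by (rule prob_all_sub) auto
  then show ?thesis by (simp add: * card_alphabet sub_apply)
qed

text \<open>Strict convexity: the slope of \<open>s \<mapsto> (1 - p + p s)^M\<close> between \<open>s\<close> and \<open>1\<close>, a geometric sum, is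
  strictly increasing in \<open>s\<close>. It equals \<open>1\<close> at \<open>\<eta>\<close> and is at most \<open>1\<close> at \<open>s\<close>.\<close>

lemma offspring_fixpoint:
  fixes p s \<eta> :: real
  assumes p: "0 < p" "p \<le> 1" and M: "M \<ge> 2" and \<eta>: "0 \<le> \<eta>" "\<eta> \<le> s" and s: "s < 1"
    and fix\<eta>: "\<eta> = (1 - p + p * \<eta>) ^ M" and les: "s \<le> (1 - p + p * s) ^ M"
  shows "s = \<eta>"
proof (rule ccontr)
  assume "s \<noteq> \<eta>"
  with \<eta> have lt: "\<eta> < s" by simp
  define x y where "x = 1 - p + p * \<eta>" and "y = 1 - p + p * s"
  have x0: "0 \<le> x" using p \<eta> by (simp add: x_def)
  have xy: "x < y" using p lt by (simp add: x_def y_def)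
  have sum_lt: "(\<Sum>i<M. x ^ i) < (\<Sum>i<M. y ^ i)"
  proof (rule sum_strict_mono_ex1)
    show "\<forall>i\<in>{..<M}. x ^ i \<le> y ^ i" using x0 xy by (auto intro: power_mono)
    show "\<exists>i\<in>{..<M}. x ^ i < y ^ i" using M xy by (intro bexI[of _ 1]) auto
  qed simp
  have "p * (1 - \<eta>) * (\<Sum>i<M. x ^ i) = 1 - x ^ M"
    using one_diff_power_eq[of x M] by (simp add: x_def algebra_simps)
  also have "\<dots> = 1 - \<eta>" using fix\<eta> by (simp add: x_def)
  finally have "(1 - \<eta>) * (p * (\<Sum>i<M. x ^ i)) = (1 - \<eta>) * 1" by (simp add: mult_ac)
  then have 1: "p * (\<Sum>i<M. x ^ i) = 1" using lt s by (subst (asm) mult_left_cancel) auto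
  have "p * (1 - s) * (\<Sum>i<M. y ^ i) = 1 - y ^ M"
    using one_diff_power_eq[of y M] by (simp add: y_def algebra_simps)
  also have "\<dots> \<le> 1 - s" using les by (simp add: y_def)
  finally have "(1 - s) * (p * (\<Sum>i<M. y ^ i)) \<le> (1 - s) * 1" by (simp add: mult_ac)
  then have 2: "p * (\<Sum>i<M. y ^ i) \<le> 1" using s by (subst (asm) mult_le_cancel_left_pos) auto
  from sum_lt p have "p * (\<Sum>i<M. x ^ i) < p * (\<Sum>i<M. y ^ i)" by simp
  with 1 2 show False by simp
qed

lemma AE_nonextinct_imp_good:
  fixes p :: real and b n K :: nat
  assumes p: "0 < p" "p < 1" and b: "b \<ge> 2" and K: "K > 0"
    and pos: "0 < measure (perc_space p) {\<omega> :: ('n::finite \<Rightarrow> nat) list \<Rightarrow> bool. good_inf b n K \<omega>}"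
  shows "AE \<omega> in (perc_space p :: (('n \<Rightarrow> nat) list \<Rightarrow> bool) measure).
    nonextinct b \<omega> \<longrightarrow> (\<exists>v. in_tree b \<omega> v \<and> good_inf b n K (sub v \<omega>))"
proof -
  interpret prob_space "perc_space p :: (('n \<Rightarrow> nat) list \<Rightarrow> bool) measure"
    by (rule prob_space_perc_space)
  have ev: "{\<omega>. Q \<omega>} \<in> events" if "Measurable.pred (perc_space p) Q" for Q
    using that by (simp add: pred_def)
  define bad :: "(('n \<Rightarrow> nat) list \<Rightarrow> bool) \<Rightarrow> bool"
    where "bad \<omega> \<longleftrightarrow> (\<forall>v. in_tree b \<omega> v \<longrightarrow> \<not> good_inf b n K (sub v \<omega>))" for \<omega>
  have [measurable]: "Measurable.pred (perc_space p) bad"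
    unfolding bad_def[abs_def] by measurable
  have "good_inf b n K (sub v (fun_upd \<omega> [] c)) = good_inf b n K (sub v \<omega>)" for v and \<omega> :: "('n \<Rightarrow> nat) list \<Rightarrow> bool" and c
    using rootfree_good[of b n K] by (cases "v = []") (auto simp: sub_upd_root good_inf_def rootfree_def)
  then have rf: "rootfree bad" by (simp add: rootfree_def bad_def in_tree_upd_root)
  let ?s = "prob {\<omega>. bad \<omega>}" and ?\<eta> = "prob {\<omega>. \<not> nonextinct b \<omega>}"
  have ext_bad: "bad \<omega>" if "\<not> nonextinct b \<omega>" for \<omega>
  proof (rule ccontr)
    assume "\<not> bad \<omega>"
    then obtain v where v: "in_tree b \<omega> v" "good_inf b n K (sub v \<omega>)" by (auto simp: bad_def)
    have "\<exists>w. length w = k \<and> in_tree b \<omega> w" for k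
    proof -
      obtain w where w: "length w \<ge> k" "in_tree b (sub v \<omega>) w" using good_inf_imp_deep[OF v(2) K, of k] b by auto
      then have "in_tree b \<omega> (take k (v @ w))" using v by (intro in_tree_take) (simp add: in_tree_append)
      then show ?thesis using w by (intro exI[of _ "take k (v @ w)"]) simp
    qed
    then show False using that by (simp add: nonextinct_def)
  qed
  have "?\<eta> = prob {\<omega>. \<forall>j\<in>alphabet b. \<omega> [j] \<longrightarrow> \<not> nonextinct b (sub [j] \<omega>)}"
    by (subst nonextinct_iff) (metis (no_types))
  also have "\<dots> = (1 - p + p * ?\<eta>) ^ (b ^ CARD('n))"
    using p rootfree_nonextinct by (intro prob_all_children) (auto simp: rootfree_def)
  finally have \<eta>: "?\<eta> = (1 - p + p * ?\<eta>) ^ (b ^ CARD('n))" .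
  \<comment> \<open>Badness passes to retained children. This inclusion makes \<open>?s\<close> a
    subsolution, which is all that the convexity argument needs; extinction satisfies the equation
    itself.\<close>
  have "?s \<le> prob {\<omega>. \<forall>j\<in>alphabet b. \<omega> [j] \<longrightarrow> bad (sub [j] \<omega>)}"
  proof (rule finite_measure_mono)
    show "{\<omega>. bad \<omega>} \<subseteq> {\<omega>. \<forall>j\<in>alphabet b. \<omega> [j] \<longrightarrow> bad (sub [j] \<omega>)}"
    proof safe
      fix \<omega> :: "('n \<Rightarrow> nat) list \<Rightarrow> bool" and j assume "bad \<omega>" "j \<in> alphabet b" "\<omega> [j]"
      then have "in_tree b (sub [j] \<omega>) v \<Longrightarrow> \<not> good_inf b n K (sub (j # v) \<omega>)" for v
        unfolding bad_def by (metis in_tree_Cons)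
      then show "bad (sub [j] \<omega>)" by (simp add: bad_def sub_sub)
    qed
    show "{\<omega>. \<forall>j\<in>alphabet b. \<omega> [j] \<longrightarrow> bad (sub [j] \<omega>)} \<in> events" by (rule ev) simp
  qed
  also have "\<dots> = (1 - p + p * ?s) ^ (b ^ CARD('n))"
    using p rf by (intro prob_all_children) auto
  finally have s: "?s \<le> (1 - p + p * ?s) ^ (b ^ CARD('n))" .
  \<comment> \<open>The assumption \<open>pos\<close> enters as \<open>?s < 1\<close>, which rules
    out the trivial fixed point. Extinct trees are bad, so equal probabilities make the surviving
    bad trees a null set.\<close>
  have "?s = ?\<eta>"
  proof (rule offspring_fixpoint[OF _ _ _ _ _ _ \<eta> s])
    have "b ^ 1 \<le> b ^ CARD('n)" using b by (intro power_increasing) (auto simp: Suc_le_eq)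
    then show "2 \<le> b ^ CARD('n)" using b by simp
    show "?\<eta> \<le> ?s" by (rule finite_measure_mono) (auto intro: ext_bad ev)
    have "?s \<le> prob {\<omega>. \<not> good_inf b n K \<omega>}"
      by (rule finite_measure_mono) (auto intro!: ev simp: bad_def dest: spec[of _ "[]"])
    also have "\<dots> = 1 - prob {\<omega>. good_inf b n K \<omega>}"
      using prob_compl[OF ev[OF measurable_good_inf]] by (simp add: Compl_eq_Diff_UNIV[symmetric] Collect_neg_eq)
    finally show "?s < 1" using pos by simp
  qed (use p in auto)
  moreover have "prob ({\<omega>. bad \<omega>} - {\<omega>. \<not> nonextinct b \<omega>}) = ?s - ?\<eta>"
    by (rule finite_measure_Diff) (auto intro: ev ext_bad)
  ultimately have "prob ({\<omega>. bad \<omega>} - {\<omega>. \<not> nonextinct b \<omega>}) = 0" by simp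
  moreover have "{\<omega>. bad \<omega>} - {\<omega>. \<not> nonextinct b \<omega>} \<in> events" by (intro sets.Diff ev) auto
  ultimately have "{\<omega>. bad \<omega>} - {\<omega>. \<not> nonextinct b \<omega>} \<in> null_sets (perc_space p)"
    by (simp add: null_sets_def emeasure_eq_measure)
  then show ?thesis
    by (rule AE_I') (auto simp: bad_def)
qed

subsection \<open>The image of a regular subtree\<close>

text \<open>Horner value of the \<open>i\<close>-th digits: the position, in multiples of
  \<open>b\<close> to the power minus \<open>length w\<close>, of the lower corner of the cube coded
  by \<open>w\<close>.\<close>

definition code_num :: "nat \<Rightarrow> 'n \<Rightarrow> ('n \<Rightarrow> nat) list \<Rightarrow> nat" where
  "code_num b i w = foldl (\<lambda>a j. a * b + j i) 0 w"

lemma code_num_Nil [simp]: "code_num b i [] = 0"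
  by (simp add: code_num_def)

lemma code_num_snoc [simp]: "code_num b i (w @ [j]) = code_num b i w * b + j i"
  by (simp add: code_num_def)

lemma code_num_inj:
  assumes "length w = length w'" "set w \<subseteq> alphabet b" "set w' \<subseteq> alphabet b"
    and "\<And>i. code_num b i w = code_num b i w'"
  shows "w = w'"
  using assms
proof (induction w arbitrary: w' rule: rev_induct)
  case (snoc j w)
  then obtain j' v where w': "w' = v @ [j']" by (cases w' rule: rev_exhaust) auto
  have lt: "j i < b" "j' i < b" for i using snoc.prems w' by (auto simp: alphabet_def)
  have eq: "code_num b i w * b + j i = code_num b i v * b + j' i" for i
    using snoc.prems(4)[of i] w' by simp
  have "j i = j' i" for i using arg_cong[OF eq[of i], of "\<lambda>x. x mod b"] lt[of i] by simp
  moreover have "code_num b i w = code_num b i v" for i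
  proof -
    have b: "b \<noteq> 0" using lt[of i] by auto
    show ?thesis using arg_cong[OF eq[of i], of "\<lambda>x. x div b"] lt[of i] b by simp
  qed
  then have "w = v" using snoc.prems w' by (intro snoc.IH) auto
  ultimately show ?case using w' by auto
qed simp

lemma digit_sums:
  assumes b: "b \<ge> 2" and s: "\<And>k. s k \<in> alphabet b"
  shows "summable (\<lambda>k. real (s k i) / real b ^ Suc k)"
    and "0 \<le> (\<Sum>k. real (s k i) / real b ^ Suc k)"
    and "(\<Sum>k. real (s k i) / real b ^ Suc k) \<le> 1"
proof -
  have le: "real (s k i) / real b ^ Suc k \<le> (real b - 1) / real b * (1 / real b) ^ k" for k
  proof -
    have "s k i < b" using s by (simp add: alphabet_def)
    then have "real (s k i) \<le> real b - 1" by linarith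
    then have "real (s k i) / real b ^ Suc k \<le> (real b - 1) / real b ^ Suc k"
      by (rule divide_right_mono) simp
    then show ?thesis by (simp add: power_divide)
  qed
  have "(\<lambda>k. (real b - 1) / real b * (1 / real b) ^ k) sums ((real b - 1) / real b * (1 / (1 - 1 / real b)))"
    using b by (intro sums_mult geometric_sums) simp
  also have "(real b - 1) / real b * (1 / (1 - 1 / real b)) = 1"
    using b by (simp add: field_simps)
  finally have geo: "(\<lambda>k. (real b - 1) / real b * (1 / real b) ^ k) sums 1" .
  show sm: "summable (\<lambda>k. real (s k i) / real b ^ Suc k)"
    using le by (intro summable_comparison_test'[OF sums_summable[OF geo]]) auto
  show "0 \<le> (\<Sum>k. real (s k i) / real b ^ Suc k)" by (rule suminf_nonneg[OF sm]) simp
  have "(\<Sum>k. real (s k i) / real b ^ Suc k) \<le> (\<Sum>k. (real b - 1) / real b * (1 / real b) ^ k)"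
    by (rule suminf_le[OF le sm sums_summable[OF geo]])
  then show "(\<Sum>k. real (s k i) / real b ^ Suc k) \<le> 1" using sums_unique[OF geo] by simp
qed

text \<open>The tail is itself a digit series, rescaled, with values in the closed unit interval.
  Neighbouring cubes share boundary points, so a point need not determine its word.\<close>

lemma gamma_b_bounds:
  assumes b: "b \<ge> 2" and s: "\<And>k. s k \<in> alphabet b" and w: "map s [0..<n] = w"
  shows "real (code_num b i w) / real b ^ n \<le> gamma_b b s $ i"
    and "gamma_b b s $ i \<le> (real (code_num b i w) + 1) / real b ^ n"
proof -
  let ?f = "\<lambda>k. real (s k i) / real b ^ Suc k"
  have head: "(\<Sum>k<n. ?f k) = real (code_num b i w) / real b ^ n"
    unfolding w[symmetric]
  proof (induction n)
    case (Suc n)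
    have "(\<Sum>k<Suc n. ?f k) = real (code_num b i (map s [0..<n])) / real b ^ n + real (s n i) / real b ^ Suc n"
      by (simp only: sum.lessThan_Suc Suc.IH)
    also have "\<dots> = real (code_num b i (map s [0..<Suc n])) / real b ^ Suc n"
      using b by (simp add: field_simps)
    finally show ?case .
  qed simp
  have "gamma_b b s $ i = (\<Sum>k. ?f (k + n)) + (\<Sum>k<n. ?f k)"
    unfolding gamma_b_def using suminf_split_initial_segment[OF digit_sums(1)[where s=s and i=i, OF b s], where k=n] by simp
  also have "(\<Sum>k. ?f (k + n)) = (\<Sum>k. (real (s (k + n) i) / real b ^ Suc k) * (1 / real b ^ n))"
    by (simp add: power_add mult_ac)
  also have "\<dots> = (\<Sum>k. real (s (k + n) i) / real b ^ Suc k) * (1 / real b ^ n)"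
    by (rule suminf_mult2[symmetric]) (rule digit_sums(1)[OF b s])
  finally have eq: "gamma_b b s $ i = (\<Sum>k. real (s (k + n) i) / real b ^ Suc k) / real b ^ n + real (code_num b i w) / real b ^ n"
    unfolding head by (simp only: times_divide_eq_right mult_1_right)
  have bn: "real b ^ n > 0" using b by simp
  note t = digit_sums(2,3)[where s="\<lambda>k. s (k + n)" and i=i, OF b s]
  show "real (code_num b i w) / real b ^ n \<le> gamma_b b s $ i"
    using t(1) bn by (simp add: eq)
  have "(\<Sum>k. real (s (k + n) i) / real b ^ Suc k) / real b ^ n \<le> 1 / real b ^ n"
    using t(2) bn by (intro divide_right_mono) auto
  then show "gamma_b b s $ i \<le> (real (code_num b i w) + 1) / real b ^ n"
    by (simp add: eq add_divide_distrib)
qed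

lemma dist_gamma_b_le:
  fixes s s' :: "nat \<Rightarrow> 'n::finite \<Rightarrow> nat"
  assumes b: "b \<ge> 2" and s: "\<And>k. s k \<in> alphabet b" "\<And>k. s' k \<in> alphabet b"
    and eq: "map s [0..<n] = map s' [0..<n]"
  shows "dist (gamma_b b s) (gamma_b b s') \<le> real CARD('n) / real b ^ n"
proof -
  have "\<bar>(gamma_b b s - gamma_b b s') $ i\<bar> \<le> 1 / real b ^ n" for i
    using gamma_b_bounds[where s=s and i=i, OF b s(1) refl, of n] 
      gamma_b_bounds[where s=s' and i=i, OF b s(2) eq[symmetric]]
    by (simp add: add_divide_distrib abs_le_iff)
  then have "(\<Sum>i\<in>UNIV. \<bar>(gamma_b b s - gamma_b b s') $ i\<bar>) \<le> (\<Sum>i\<in>(UNIV :: 'n set). 1 / real b ^ n)"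
    by (intro sum_mono)
  with norm_le_l1_cart[of "gamma_b b s - gamma_b b s'"] show ?thesis
    by (simp add: dist_norm)
qed

lemma card_nat_near_le:
  fixes y C :: real
  assumes "C \<ge> 0"
  shows "finite {z :: nat. \<bar>real z - y\<bar> \<le> C}" "card {z :: nat. \<bar>real z - y\<bar> \<le> C} \<le> nat \<lfloor>2 * C\<rfloor> + 1"
proof -
  let ?S = "{z :: nat. \<bar>real z - y\<bar> \<le> C}"
  \<comment> \<open>The window starts at the least element of the set, a natural number even where
    \<open>y - C\<close> is negative.\<close>
  have "?S \<subseteq> {(LEAST z. z \<in> ?S)..(LEAST z. z \<in> ?S) + nat \<lfloor>2 * C\<rfloor>}"
  proof
    fix z assume z: "z \<in> ?S"
    then have 1: "(LEAST z. z \<in> ?S) \<le> z" and 2: "(LEAST z. z \<in> ?S) \<in> ?S"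
      by (rule Least_le, rule LeastI)
    let ?l = "LEAST z. z \<in> ?S"
    have "real z - real ?l \<le> 2 * C" using z 2 unfolding mem_Collect_eq by linarith
    then have "real_of_int (int z - int ?l) \<le> 2 * C" by simp
    then have "int z - int ?l \<le> \<lfloor>2 * C\<rfloor>" by (simp only: le_floor_iff)
    then show "z \<in> {?l..?l + nat \<lfloor>2 * C\<rfloor>}" using 1 by auto
  qed
  then show "finite ?S" "card ?S \<le> nat \<lfloor>2 * C\<rfloor> + 1"
    using finite_subset card_mono[of "{(LEAST z. z \<in> ?S)..(LEAST z. z \<in> ?S) + nat \<lfloor>2 * C\<rfloor>}" ?S] by auto
qed

section \<open>Deterministic block trees and their codes\<close>

text \<open>Separates the geometry from the randomness: \<open>e w\<close> lists \<open>L\<close>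
  block extensions of \<open>w\<close>. It is total in \<open>w\<close>, so no invariant about
  reachable words is needed here; that the coded words lie in the random tree is shown after
  interpretation.\<close>

locale block_code =
  fixes b N L :: nat and v0 :: "('n::finite \<Rightarrow> nat) list"
    and e :: "('n \<Rightarrow> nat) list \<Rightarrow> nat \<Rightarrow> ('n \<Rightarrow> nat) list"
  assumes b: "b \<ge> 2" and N: "N > 0" and L: "L \<ge> 2" and v0: "set v0 \<subseteq> alphabet b"
    and e_words: "i < L \<Longrightarrow> e w i \<in> words b N"
    and e_inj: "inj_on (e w) {..<L}"
    and e_doubled: "j \<in> alphabet b \<Longrightarrow> \<exists>i<L. take 2 (e w i) = [j, j]"
begin

text \<open>Sequences of child indices instead of words: all vertices share one index set, so the
  uniform measure on the tree is a plain product measure.\<close>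

definition codes :: "(nat \<Rightarrow> nat) set" where
  "codes = PiE UNIV (\<lambda>_. {..<L})"

primrec cw :: "(nat \<Rightarrow> nat) \<Rightarrow> nat \<Rightarrow> ('n \<Rightarrow> nat) list" where
  "cw t 0 = v0"
| "cw t (Suc k) = cw t k @ e (cw t k) (t k)"

text \<open>For codes, \<open>Suc n\<close> blocks contain at least \<open>Suc n\<close> letters
  because \<open>N > 0\<close>, so position \<open>n\<close> exists.\<close>

definition iw :: "(nat \<Rightarrow> nat) \<Rightarrow> nat \<Rightarrow> 'n \<Rightarrow> nat" where
  "iw t n = cw t (Suc n) ! n"

definition pt :: "(nat \<Rightarrow> nat) \<Rightarrow> real ^ 'n" where
  "pt t = gamma_b b (iw t)"

definition r :: "nat \<Rightarrow> real" where
  "r k = 1 / real b ^ (length v0 + N * k)"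

definition cyl :: "(nat \<Rightarrow> nat) \<Rightarrow> nat \<Rightarrow> (nat \<Rightarrow> nat) set" where
  "cyl t k = {t' \<in> codes. \<forall>l<k. t' l = t l}"

definition D :: "(real ^ 'n) set" where
  "D = pt ` codes"

text \<open>The similarity dimension: \<open>L\<close> children, each scaled by \<open>b^-N\<close>,
  give \<open>L = b^(N * \<delta>)\<close>.\<close>

definition \<delta> :: real where
  "\<delta> = log (real b) (real L) / real N"

lemma codes_lt: "t \<in> codes \<Longrightarrow> t k < L"
  by (auto simp: codes_def PiE_def)

lemma codesI: "(\<And>k. t k < L) \<Longrightarrow> t \<in> codes"
  by (auto simp: codes_def)

lemma length_cw: "t \<in> codes \<Longrightarrow> length (cw t k) = length v0 + N * k"
  by (induction k) (use e_words codes_lt in \<open>auto simp: words_def\<close>)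

lemma set_cw: "t \<in> codes \<Longrightarrow> set (cw t k) \<subseteq> alphabet b"
proof (induction k)
  case (Suc k)
  then show ?case using e_words[OF codes_lt[OF Suc.prems, of k], of "cw t k"] by (auto simp: words_def)
qed (use v0 in simp)

lemma cw_nth_mono: "k \<le> l \<Longrightarrow> n < length (cw t k) \<Longrightarrow> cw t l ! n = cw t k ! n \<and> n < length (cw t l)"
  by (induction l rule: dec_induct) (auto simp: nth_append)

lemma map_iw: 
  assumes "t \<in> codes"
  shows "map (iw t) [0..<length (cw t k)] = cw t k"
proof (rule nth_equalityI)
  fix n assume "n < length (map (iw t) [0..<length (cw t k)])"
  then have n: "n < length (cw t k)" by simp
  have "n < length (cw t (Suc n))"
    using assms N length_cw[of t "Suc n"] by (cases N) auto
  then have "cw t (Suc n) ! n = cw t k ! n"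
    using n cw_nth_mono[of k "Suc n" n t] cw_nth_mono[of "Suc n" k n t] by (cases "k \<le> Suc n") auto
  then show "map (iw t) [0..<length (cw t k)] ! n = cw t k ! n" using n by (simp add: iw_def)
qed simp

lemma iw_alphabet: "t \<in> codes \<Longrightarrow> iw t n \<in> alphabet b"
proof -
  assume t: "t \<in> codes"
  then have "n < length (cw t (Suc n))"
    using N length_cw[of t "Suc n"] by (cases N) auto
  then show ?thesis using set_cw[OF t, of "Suc n"] nth_mem unfolding iw_def by blast
qed

lemma map_iw_take:
  assumes "t \<in> codes" "n \<le> length (cw t k)"
  shows "map (iw t) [0..<n] = take n (cw t k)"
proof -
  have "take n (map (iw t) [0..<length (cw t k)]) = map (iw t) [0..<n]"
    using assms(2) by (simp add: take_map)
  then show ?thesis by (simp add: map_iw assms(1))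
qed

lemma cw_cong: "(\<And>l. l < k \<Longrightarrow> t l = t' l) \<Longrightarrow> cw t k = cw t' k"
  by (induction k) auto

lemma cw_inj:
  assumes "t \<in> codes" "t' \<in> codes"
  shows "cw t k = cw t' k \<Longrightarrow> l < k \<Longrightarrow> t l = t' l"
proof (induction k)
  case (Suc k)
  have eq: "cw t k = cw t' k" "e (cw t k) (t k) = e (cw t' k) (t' k)"
    using Suc.prems(1) length_cw assms by auto
  then have "t k = t' k"
    using inj_onD[OF e_inj, of "cw t k" "t k" "t' k"] codes_lt assms by auto
  with Suc eq show ?case by (cases "l = k") auto
qed simp

lemma r_pos: "r k > 0"
  using b by (simp add: r_def)

lemma r_Suc: "r k = real b ^ N * r (Suc k)"
  using b by (simp add: r_def power_add)

lemma r_eq: "r k = r 0 * (1 / real b ^ N) ^ k"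
  by (simp add: r_def power_add power_mult power_divide)

lemma r_tendsto: "r \<longlonglongrightarrow> 0"
proof -
  have "1 < real b ^ N" using b N by simp
  then have "(\<lambda>k. r 0 * (1 / real b ^ N) ^ k) \<longlonglongrightarrow> r 0 * 0"
    by (intro tendsto_mult tendsto_const LIMSEQ_power_zero) (simp add: divide_simps)
  moreover have "r = (\<lambda>k. r 0 * (1 / real b ^ N) ^ k)" by (rule ext) (rule r_eq)
  ultimately show ?thesis by (metis mult_zero_right)
qed

lemma dist_pt_le:
  assumes "t \<in> codes" "t' \<in> codes" "cw t k = cw t' k"
  shows "dist (pt t) (pt t') \<le> real CARD('n) * r k"
proof -
  have "dist (pt t) (pt t') \<le> real CARD('n) / real b ^ length (cw t k)"
    unfolding pt_def using assms map_iw[of t k] map_iw[of t' k]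
    by (intro dist_gamma_b_le b iw_alphabet) auto
  then show ?thesis using assms by (simp add: length_cw r_def)
qed

lemma pt_bounds:
  assumes "t \<in> codes"
  shows "real (code_num b i (cw t k)) * r k \<le> pt t $ i"
    and "pt t $ i \<le> (real (code_num b i (cw t k)) + 1) * r k"
  using gamma_b_bounds[OF b iw_alphabet map_iw, OF assms assms, of i k] assms
  by (simp_all add: pt_def r_def length_cw)

text \<open>For the least admissible \<open>k\<close>, failure at the previous level gives the upper
  bound with a factor \<open>b^N\<close>; for \<open>k = 0\<close> there is no previous level, and
  \<open>\<rho> < 1\<close> supplies the factor \<open>1 / r 0\<close>.\<close>

lemma scale_exists:
  assumes c: "c > 0"
  obtains C where "C > 0" "\<And>\<rho>. 0 < \<rho> \<Longrightarrow> \<rho> < 1 \<Longrightarrow> \<exists>k. c * r k < \<rho> \<and> \<rho> \<le> C * r k"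
proof
  define C where "C = max (c * real b ^ N) (1 / r 0)"
  show "C > 0" using r_pos[of 0] by (simp add: C_def less_max_iff_disj)
  fix \<rho> :: real assume \<rho>: "0 < \<rho>" "\<rho> < 1"
  have "(\<lambda>k. c * r k) \<longlonglongrightarrow> c * 0" by (intro tendsto_intros r_tendsto)
  then have "\<forall>\<^sub>F k in sequentially. c * r k < \<rho>" using \<rho> by (intro order_tendstoD) auto
  then have ex: "\<exists>k. c * r k < \<rho>" by (auto simp: eventually_sequentially)
  define k where "k = (LEAST k. c * r k < \<rho>)"
  have k: "c * r k < \<rho>" unfolding k_def using ex by (rule LeastI_ex)
  have "\<rho> \<le> C * r k"
  proof (cases k)
    case 0
    have "1 = 1 / r 0 * r 0" using r_pos[of 0] by simp
    also have "\<dots> \<le> C * r 0" using r_pos[of 0] by (intro mult_right_mono) (auto simp: C_def)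
    finally show ?thesis using \<rho> 0 by simp
  next
    case (Suc l)
    then have "\<not> c * r l < \<rho>" using not_less_Least[of l "\<lambda>k. c * r k < \<rho>"] by (simp add: k_def)
    then have "\<rho> \<le> c * real b ^ N * r k" using r_Suc[of l] Suc by (simp add: mult_ac)
    also have "\<dots> \<le> C * r k" using r_pos[of k] by (intro mult_right_mono) (auto simp: C_def)
    finally show ?thesis .
  qed
  with k show "\<exists>k. c * r k < \<rho> \<and> \<rho> \<le> C * r k" by blast
qed

lemma \<delta>_pos: "\<delta> > 0"
  using b L N by (simp add: \<delta>_def)

lemma powr_r: "(r k / r 0) powr \<delta> = (1 / real L) ^ k"
proof -
  have b0: "real b > 0" "real b \<noteq> 1" and L0: "real L > 0" using b L by auto
  have "r k / r 0 = real b powr (- real (N * k))"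
    using b by (simp add: r_def power_add powr_minus_divide powr_realpow del: of_nat_mult)
  then have "(r k / r 0) powr \<delta> = real b powr (- real (N * k) * \<delta>)"
    by (simp add: powr_powr)
  also have "- real (N * k) * \<delta> = log (real b) (real L) * (- real k)"
    using N by (simp add: \<delta>_def)
  also have "real b powr \<dots> = real L powr (- real k)"
  proof -
    have "real b powr log (real b) (real L) = real L" using b0 L0 by simp
    then show ?thesis by (simp only: powr_powr[symmetric])
  qed
  also have "\<dots> = (1 / real L) ^ k"
    using L0 by (simp add: powr_minus powr_realpow power_divide divide_inverse power_inverse)
  finally show ?thesis .
qed

section \<open>The uniform measure and its ball estimates\<close>

definition Mt :: "(nat \<Rightarrow> nat) measure" where
  "Mt = PiM UNIV (\<lambda>_. uniform_count_measure {..<L})"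

lemma space_Mt: "space Mt = codes"
  by (simp add: Mt_def space_PiM codes_def space_uniform_count_measure)

lemma prob_space_Mt: "prob_space Mt"
  unfolding Mt_def using L
  by (intro prob_space_PiM prob_space_uniform_count_measure) (auto simp: lessThan_empty_iff)

lemma measurable_component_Mt: "(\<lambda>t. h (t k)) \<in> measurable Mt (count_space UNIV)"
proof -
  have "(\<lambda>t. t k) \<in> measurable Mt (uniform_count_measure {..<L})"
    unfolding Mt_def by (rule measurable_component_singleton) simp
  moreover have "h \<in> measurable (uniform_count_measure {..<L}) (count_space UNIV)"
    by (auto simp: measurable_def space_uniform_count_measure sets_uniform_count_measure)
  ultimately show ?thesis by (rule measurable_compose)
qed

lemma measurable_cw: "(\<lambda>t. cw t k) \<in> measurable Mt (count_space UNIV)"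
proof (induction k)
  case (Suc k)
  show ?case
    using measurable_compose_countable[where f="\<lambda>w t. w @ e w (t k)", OF measurable_component_Mt Suc]
    by simp
qed simp

lemma measurable_pt [measurable]: "pt \<in> borel_measurable Mt"
proof -
  have "(\<lambda>t. real (iw t k i)) \<in> borel_measurable Mt" for k i
    unfolding iw_def using measurable_compose[OF measurable_cw[of "Suc k"], of "\<lambda>w. real ((w ! k) i)" borel] by simp
  then have "(\<lambda>t. \<Sum>k. real (iw t k i) / real b ^ Suc k) \<in> borel_measurable Mt" for i
    by (intro borel_measurable_suminf borel_measurable_divide) auto
  then have "(\<lambda>t. pt t $ i) \<in> borel_measurable Mt" for i
    by (simp add: pt_def gamma_b_def)
  then show ?thesis
    by (subst borel_measurable_euclidean_space) (auto simp: Basis_vec_def inner_axis)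
qed

lemma emeasure_cyl:
  assumes t: "t \<in> codes"
  shows "cyl t k \<in> sets Mt" "emeasure Mt (cyl t k) = ennreal ((1 / real L) ^ k)"
proof -
  let ?U = "uniform_count_measure {..<L}"
  have eq: "cyl t k = prod_emb UNIV (\<lambda>_. ?U) {..<k} (PiE {..<k} (\<lambda>l. {t l}))"
    by (auto simp: cyl_def prod_emb_def codes_def space_uniform_count_measure PiE_iff)
  have tl: "{t l} \<in> sets ?U" for l
    using codes_lt[OF t, of l] by (simp add: sets_uniform_count_measure)
  show "cyl t k \<in> sets Mt"
    unfolding eq Mt_def by (rule sets_PiM_I) (auto intro: tl)
  have "emeasure Mt (cyl t k) = (\<Prod>l<k. emeasure ?U {t l})"
    unfolding eq Mt_def using L
    by (intro emeasure_PiM_emb prob_space_uniform_count_measure tl) (auto simp: lessThan_empty_iff)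
  also have "\<dots> = (\<Prod>l<k. ennreal (1 / real L))"
    using codes_lt[OF t] by (intro prod.cong refl) (simp add: emeasure_uniform_count_measure)
  also have "\<dots> = ennreal ((1 / real L) ^ k)" by (simp add: ennreal_power)
  finally show "emeasure Mt (cyl t k) = ennreal ((1 / real L) ^ k)" .
qed

definition \<mu> :: "(real ^ 'n) measure" where
  "\<mu> = distr Mt borel pt"

lemma sets_\<mu> [simp]: "sets \<mu> = sets borel"
  by (simp add: \<mu>_def)

lemma emeasure_\<mu>: "A \<in> sets borel \<Longrightarrow> emeasure \<mu> A = emeasure Mt {t \<in> codes. pt t \<in> A}"
  unfolding \<mu>_def by (subst emeasure_distr) (auto simp: space_Mt vimage_def Int_def conj_commute)

text \<open>The ball around a point of \<open>D\<close> contains the image of a whole cylinder of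
  comparable size, whose mass is \<open>(r k / r 0) powr \<delta>\<close> by
  \<open>powr_r\<close>.\<close>

lemma \<mu>_ball_ge:
  obtains c1 where "c1 > 0"
    "\<And>x \<rho>. x \<in> D \<Longrightarrow> 0 < \<rho> \<Longrightarrow> \<rho> < 1 \<Longrightarrow> ennreal (c1 * \<rho> powr \<delta>) \<le> emeasure \<mu> (ball x \<rho>)"
proof -
  obtain C where C: "C > 0" 
    "\<And>\<rho>. 0 < \<rho> \<Longrightarrow> \<rho> < 1 \<Longrightarrow> \<exists>k. real CARD('n) * r k < \<rho> \<and> \<rho> \<le> C * r k"
    using scale_exists[of "real CARD('n)"] by auto
  show ?thesis
  proof
    show "(1 / (C * r 0)) powr \<delta> > 0" using C r_pos[of 0] by simp
    fix x \<rho> assume x: "x \<in> D" and \<rho>: "0 < \<rho>" "\<rho> < (1::real)"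
    obtain t where t: "t \<in> codes" "x = pt t" using x by (auto simp: D_def)
    obtain k where k: "real CARD('n) * r k < \<rho>" "\<rho> \<le> C * r k" using C(2) \<rho> by blast
    have "(1 / (C * r 0)) powr \<delta> * \<rho> powr \<delta> = (\<rho> / (C * r 0)) powr \<delta>"
      using \<rho> C r_pos[of 0] by (simp add: powr_mult[symmetric])
    also have "\<dots> \<le> (r k / r 0) powr \<delta>"
      using k \<rho> C r_pos[of 0] \<delta>_pos by (intro powr_mono2) (auto simp: divide_simps mult_ac)
    also have "\<dots> = (1 / real L) ^ k" by (rule powr_r)
    finally have "ennreal ((1 / (C * r 0)) powr \<delta> * \<rho> powr \<delta>) \<le> emeasure Mt (cyl t k)"
      using emeasure_cyl[OF t(1)] by (simp add: ennreal_leI)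
    also have "\<dots> \<le> emeasure Mt (pt -` ball x \<rho> \<inter> space Mt)"
    proof (rule emeasure_mono)
      show "cyl t k \<subseteq> pt -` ball x \<rho> \<inter> space Mt"
      proof
        fix t' assume t': "t' \<in> cyl t k"
        then have "t' \<in> codes" by (simp add: cyl_def)
        moreover have "cw t k = cw t' k" using t' by (intro cw_cong) (simp add: cyl_def)
        ultimately show "t' \<in> pt -` ball x \<rho> \<inter> space Mt"
          using dist_pt_le[of t t' k] t k by (auto simp: space_Mt)
      qed
      show "pt -` ball x \<rho> \<inter> space Mt \<in> sets Mt" by (rule measurable_sets[OF measurable_pt]) simp
    qed
    also have "\<dots> = emeasure \<mu> (ball x \<rho>)" unfolding \<mu>_def by (subst emeasure_distr) auto
    finally show "ennreal ((1 / (C * r 0)) powr \<delta> * \<rho> powr \<delta>) \<le> emeasure \<mu> (ball x \<rho>)" .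
  qed
qed

text \<open>A ball of radius comparable to \<open>r k\<close> meets boundedly many level
  \<open>k\<close> cubes, and each cube comes from at most one cylinder.\<close>

lemma \<mu>_ball_le:
  obtains c2 where "c2 > 0"
    "\<And>x \<rho>. 0 < \<rho> \<Longrightarrow> \<rho> < 1 \<Longrightarrow> emeasure \<mu> (ball x \<rho>) \<le> ennreal (c2 * \<rho> powr \<delta>)"
proof -
  obtain C where C: "C > 0" "\<And>\<rho>. 0 < \<rho> \<Longrightarrow> \<rho> < 1 \<Longrightarrow> \<exists>k. 1 * r k < \<rho> \<and> \<rho> \<le> C * r k"
    using scale_exists[of 1] by auto
  \<comment> \<open>In units of \<open>r k\<close> the ball has radius at most \<open>C\<close> and
    a cube has side \<open>1\<close>, so corner positions lie within \<open>C + 1\<close> of the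
    centre in each coordinate; \<open>B\<close> bounds how many integers do.\<close>
  define B where "B = nat \<lfloor>2 * (C + 1)\<rfloor> + 1"
  show ?thesis
  proof
    show "real B ^ CARD('n) * (1 / r 0) powr \<delta> > 0" using r_pos[of 0] by (simp add: B_def)
    fix x :: "real ^ 'n" and \<rho> assume \<rho>: "0 < \<rho>" "\<rho> < (1::real)"
    obtain k where k: "r k < \<rho>" "\<rho> \<le> C * r k" using C(2) \<rho> by auto
    define Z where "Z = PiE (UNIV :: 'n set) (\<lambda>i. {z :: nat. \<bar>real z - x $ i / r k\<bar> \<le> C + 1})"
    have finZ: "finite Z" unfolding Z_def using C by (intro finite_PiE card_nat_near_le) auto
    have "card Z = (\<Prod>i\<in>UNIV. card {z :: nat. \<bar>real z - x $ i / r k\<bar> \<le> C + 1})"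
      unfolding Z_def by (rule card_PiE) simp
    also have "\<dots> \<le> (\<Prod>i\<in>(UNIV :: 'n set). B)"
    proof (intro prod_mono conjI)
      fix i
      show "card {z :: nat. \<bar>real z - x $ i / r k\<bar> \<le> C + 1} \<le> B"
        unfolding B_def by (rule card_nat_near_le) (use C in simp)
    qed simp
    finally have cardZ: "card Z \<le> B ^ CARD('n)" by simp
    define S where "S z = {t \<in> codes. \<forall>i. code_num b i (cw t k) = z i}" for z
    \<comment> \<open>All codes in \<open>S z\<close> have the same level \<open>k\<close> word,
      hence lie in one cylinder. Passing to that cylinder gives measurability and mass at once;
      positions attained by no code get the empty set.\<close>
    define S' where "S' z = (if S z = {} then {} else cyl (SOME t. t \<in> S z) k)" for z
    have S': "S z \<subseteq> S' z" "S' z \<in> sets Mt" "emeasure Mt (S' z) \<le> ennreal ((1 / real L) ^ k)" for z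
    proof -
      show "S z \<subseteq> S' z"
      proof
        fix t assume t: "t \<in> S z"
        define u where "u = (SOME t. t \<in> S z)"
        have u: "u \<in> S z" unfolding u_def by (rule someI[of "\<lambda>t. t \<in> S z", OF t])
        have "cw t k = cw u k"
          using t u by (intro code_num_inj[of _ _ b]) (auto simp: S_def length_cw intro: set_cw[THEN subsetD])
        then have "t \<in> cyl u k" using t u cw_inj[of t u k] by (auto simp: S_def cyl_def)
        then show "t \<in> S' z" using t by (auto simp: S'_def u_def)
      qed
      show "S' z \<in> sets Mt" "emeasure Mt (S' z) \<le> ennreal ((1 / real L) ^ k)"
      proof -
        have "S z \<noteq> {} \<Longrightarrow> (SOME t. t \<in> S z) \<in> codes"
          using someI_ex[of "\<lambda>t. t \<in> S z"] by (auto simp: S_def)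
        then show "S' z \<in> sets Mt" "emeasure Mt (S' z) \<le> ennreal ((1 / real L) ^ k)"
          using emeasure_cyl by (auto simp: S'_def)
      qed
    qed
    have "emeasure \<mu> (ball x \<rho>) = emeasure Mt {t \<in> codes. pt t \<in> ball x \<rho>}"
      by (rule emeasure_\<mu>) simp
    also have "\<dots> \<le> emeasure Mt (\<Union>z\<in>Z. S' z)"
    proof (rule emeasure_mono)
      show "(\<Union>z\<in>Z. S' z) \<in> sets Mt" using S' finZ by auto
      show "{t \<in> codes. pt t \<in> ball x \<rho>} \<subseteq> (\<Union>z\<in>Z. S' z)"
      proof safe
        fix t assume t: "t \<in> codes" "pt t \<in> ball x \<rho>"
        define z where "z i = code_num b i (cw t k)" for i
        have "\<bar>real (z i) - x $ i / r k\<bar> \<le> C + 1" for i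
        proof -
          have "\<bar>(x - pt t) $ i\<bar> \<le> norm (x - pt t)" by (rule component_le_norm_cart)
          then have "\<bar>x $ i - pt t $ i\<bar> \<le> C * r k" using t k by (simp add: dist_norm)
          moreover have "real (z i) * r k \<le> pt t $ i" "pt t $ i \<le> (real (z i) + 1) * r k"
            using pt_bounds[OF t(1)] by (auto simp: z_def)
          ultimately have "\<bar>real (z i) * r k - x $ i\<bar> \<le> (C + 1) * r k" using r_pos[of k]
            by (simp add: algebra_simps abs_le_iff)
          moreover have "real (z i) - x $ i / r k = (real (z i) * r k - x $ i) / r k"
            using r_pos[of k] by (simp add: field_simps)
          ultimately show ?thesis using r_pos[of k] by (simp add: abs_divide pos_divide_le_eq)
        qed
        then have "z \<in> Z" by (auto simp: Z_def)
        moreover have "t \<in> S z" using t by (simp add: S_def z_def)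
        ultimately show "t \<in> (\<Union>z\<in>Z. S' z)" using S' by blast
      qed
    qed
    also have "\<dots> \<le> (\<Sum>z\<in>Z. emeasure Mt (S' z))"
      using finZ S' by (intro emeasure_subadditive_finite) auto
    also have "\<dots> \<le> (\<Sum>z\<in>Z. ennreal ((1 / real L) ^ k))" by (intro sum_mono S')
    also have "\<dots> = ennreal (real (card Z) * (1 / real L) ^ k)"
      by (simp add: ennreal_mult ennreal_of_nat_eq_real_of_nat)
    also have "\<dots> \<le> ennreal (real B ^ CARD('n) * (1 / r 0) powr \<delta> * \<rho> powr \<delta>)"
    proof (rule ennreal_leI)
      have "(1 / real L) ^ k = (r k / r 0) powr \<delta>" by (rule powr_r[symmetric])
      also have "\<dots> \<le> (1 / r 0 * \<rho>) powr \<delta>"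
        using k \<rho> r_pos[of 0] r_pos[of k] \<delta>_pos by (intro powr_mono2) (auto simp: divide_simps)
      also have "\<dots> = (1 / r 0) powr \<delta> * \<rho> powr \<delta>" by (rule powr_mult)
      finally have "(1 / real L) ^ k \<le> (1 / r 0) powr \<delta> * \<rho> powr \<delta>" .
      moreover have "real (card Z) \<le> real B ^ CARD('n)" using cardZ by (simp flip: of_nat_power)
      ultimately have "real (card Z) * (1 / real L) ^ k
          \<le> real B ^ CARD('n) * ((1 / r 0) powr \<delta> * \<rho> powr \<delta>)"
        by (intro mult_mono) auto
      then show "real (card Z) * (1 / real L) ^ k \<le> real B ^ CARD('n) * (1 / r 0) powr \<delta> * \<rho> powr \<delta>"
        by (simp only: mult.assoc)
    qed
    finally show "emeasure \<mu> (ball x \<rho>) \<le> ennreal (real B ^ CARD('n) * (1 / r 0) powr \<delta> * \<rho> powr \<delta>)" .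
  qed
qed

section \<open>Compactness, support and diffuseness\<close>

lemma continuous_on_pt: "continuous_on codes pt"
  unfolding continuous_on_def
proof (intro ballI tendstoI)
  fix t \<epsilon> assume t: "t \<in> codes" and \<epsilon>: "\<epsilon> > (0::real)"
  have "(\<lambda>k. real CARD('n) * r k) \<longlonglongrightarrow> real CARD('n) * 0" by (intro tendsto_intros r_tendsto)
  then have "\<forall>\<^sub>F k in sequentially. real CARD('n) * r k < \<epsilon>" using \<epsilon> by (intro order_tendstoD) auto
  then obtain k where k: "real CARD('n) * r k < \<epsilon>" by (auto simp: eventually_sequentially)
  let ?S = "PiE UNIV (\<lambda>l. if l < k then {t l} else UNIV)"
  have "open ?S" 
  proof (rule open_PiE)
    show "finite {i. (if i < k then {t i} else UNIV) \<noteq> UNIV}" by (rule finite_subset[of _ "{..<k}"]) auto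
    fix i show "open (if i < k then {t i} else UNIV)" by (rule discrete_topology_class.open_discrete)
  qed
  moreover have "t \<in> ?S" by auto
  moreover have "dist (pt t') (pt t) < \<epsilon>" if "t' \<in> ?S" "t' \<in> codes" for t'
  proof -
    have "t' l = t l" if "l < k" for l using PiE_mem[OF \<open>t' \<in> ?S\<close>, of l] that by simp
    then have "cw t' k = cw t k" by (rule cw_cong)
    then show ?thesis using dist_pt_le[OF that(2) t, of k] k by simp
  qed
  ultimately show "\<forall>\<^sub>F t' in at t within codes. dist (pt t') (pt t) < \<epsilon>"
    unfolding eventually_at_topological by blast
qed

lemma compact_D: "compact D"
proof -
  have "compactin (product_topology (\<lambda>_. euclidean) UNIV) codes"
    unfolding codes_def compactin_PiE by (simp add: finite_imp_compact)
  then have "compact codes" by (simp add: euclidean_product_topology)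
  then show ?thesis unfolding D_def by (intro compact_continuous_image continuous_on_pt)
qed

lemma emeasure_\<mu>_D: "emeasure \<mu> D = 1"
proof -
  have "D \<in> sets borel" using compact_D by (simp add: compact_imp_closed)
  then have "emeasure \<mu> D = emeasure Mt {t \<in> codes. pt t \<in> D}" by (rule emeasure_\<mu>)
  also have "{t \<in> codes. pt t \<in> D} = space Mt" by (auto simp: D_def space_Mt)
  finally show ?thesis using prob_space.emeasure_space_1[OF prob_space_Mt] by simp
qed

lemma measure_support_\<mu>: "measure_support \<mu> = D"
proof
  obtain c1 where c1: "c1 > 0"
    "\<And>x \<rho>. x \<in> D \<Longrightarrow> 0 < \<rho> \<Longrightarrow> \<rho> < 1 \<Longrightarrow> ennreal (c1 * \<rho> powr \<delta>) \<le> emeasure \<mu> (ball x \<rho>)"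
    using \<mu>_ball_ge by blast
  show "D \<subseteq> measure_support \<mu>"
    unfolding measure_support_def
  proof safe
    fix x \<rho> assume x: "x \<in> D" and \<rho>: "\<rho> > (0::real)"
    \<comment> \<open>The lower ball estimate covers only radii below \<open>1\<close>.\<close>
    let ?\<rho> = "min \<rho> (1/2)"
    have "0 < ennreal (c1 * ?\<rho> powr \<delta>)" using c1 \<rho> by simp
    also have "\<dots> \<le> emeasure \<mu> (ball x ?\<rho>)" using c1(2)[OF x, of ?\<rho>] \<rho> by simp
    also have "\<dots> \<le> emeasure \<mu> (ball x \<rho>)" by (rule emeasure_mono) auto
    finally show "0 < emeasure \<mu> (ball x \<rho>)" .
  qed
  show "measure_support \<mu> \<subseteq> D"
  proof (rule ccontr)
    assume "\<not> ?thesis"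
    then obtain x where x: "x \<in> measure_support \<mu>" "x \<notin> D" by blast
    have "open (- D)" using compact_D by (simp add: compact_imp_closed open_Compl)
    then obtain \<rho> where \<rho>: "\<rho> > 0" "ball x \<rho> \<subseteq> - D" using x by (meson ComplI openE)
    have "emeasure \<mu> (ball x \<rho>) = emeasure Mt {t \<in> codes. pt t \<in> ball x \<rho>}" by (rule emeasure_\<mu>) simp
    also have "{t \<in> codes. pt t \<in> ball x \<rho>} = {}" using \<rho> by (auto simp: D_def)
    finally show False using x(1) \<rho> by (auto simp: measure_support_def)
  qed
qed

lemma ahlfors_regular_D: "ahlfors_regular D"
proof -
  obtain c1 where c1: "c1 > 0"
    "\<And>x \<rho>. x \<in> D \<Longrightarrow> 0 < \<rho> \<Longrightarrow> \<rho> < 1 \<Longrightarrow> ennreal (c1 * \<rho> powr \<delta>) \<le> emeasure \<mu> (ball x \<rho>)"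
    using \<mu>_ball_ge by blast
  obtain c2 where c2: "c2 > 0"
    "\<And>x \<rho>. 0 < \<rho> \<Longrightarrow> \<rho> < 1 \<Longrightarrow> emeasure \<mu> (ball x \<rho>) \<le> ennreal (c2 * \<rho> powr \<delta>)"
    using \<mu>_ball_le by blast
  show ?thesis
    unfolding ahlfors_regular_def
    using c1 c2 \<delta>_pos measure_support_\<mu> by (intro exI[of _ \<mu>] exI[of _ \<delta>] exI[of _ c1] exI[of _ c2]) auto
qed

text \<open>The points of the two opposite corner subcubes selected by the signs of \<^term>\<open>a\<close> are so far
  apart in direction \<^term>\<open>a\<close> that they cannot both be close to a hyperplane orthogonal to \<^term>\<open>a\<close>.\<close>

lemma hyperplane_diffuse_D: "hyperplane_diffuse D"
proof -
  obtain C where C: "C > 0" 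
    "\<And>\<rho>. 0 < \<rho> \<Longrightarrow> \<rho> < 1 \<Longrightarrow> \<exists>k. real CARD('n) * r k < \<rho> \<and> \<rho> \<le> C * r k"
    using scale_exists[of "real CARD('n)"] by auto
  \<comment> \<open>Two points whose \<open>a\<close>-values are within
    \<open>norm a * (\<beta> * \<xi>)\<close> of \<open>c\<close> differ by less than
    \<open>norm a * \<xi> / (2 * C)\<close>, which is at most \<open>norm a * r k / 2\<close>, the
    separation of the two corners.\<close>
  define \<beta> where "\<beta> = 1 / (4 * C)"
  have main: "D \<inter> ball x \<xi> - open_nbhd H (\<beta> * \<xi>) \<noteq> {}"
    if x: "x \<in> D" and \<xi>: "0 < \<xi>" "\<xi> < 1" and H: "H \<in> affine_hyperplanes" for x \<xi> H
  proof
    assume emp: "D \<inter> ball x \<xi> - open_nbhd H (\<beta> * \<xi>) = {}"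
    obtain t where t: "t \<in> codes" "x = pt t" using x by (auto simp: D_def)
    obtain k where k: "real CARD('n) * r k < \<xi>" "\<xi> \<le> C * r k" using C(2) \<xi> by blast
    obtain a c where a: "H = {x. a \<bullet> x = c}" "a \<noteq> 0" using H by (auto simp: affine_hyperplanes_def)
    have near: "\<exists>t'. pt t' \<in> D \<and> \<bar>a \<bullet> pt t' - c\<bar> < norm a * (\<beta> * \<xi>) \<and> 
        (\<forall>i. real (code_num b i (cw t k) * b ^ 2 + j i * b + j i) * r k / b ^ 2 \<le> pt t' $ i \<and> 
          pt t' $ i \<le> real (code_num b i (cw t k) * b ^ 2 + j i * b + j i + 1) * r k / b ^ 2)"
      if j: "j \<in> alphabet b" for j
    proof -
      obtain n where n: "n < L" "take 2 (e (cw t k) n) = [j, j]" using e_doubled[OF j] by blast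
      \<comment> \<open>The index \<open>n\<close> at position \<open>k\<close> selects a block
        beginning with \<open>j j\<close>; repeating it afterwards is only a convenient
        continuation.\<close>
      define t' where "t' = (\<lambda>l. if l < k then t l else n)"
      have t': "t' \<in> codes" using n codes_lt[OF t(1)] by (intro codesI) (auto simp: t'_def)
      have cw': "cw t' k = cw t k" by (rule cw_cong) (simp add: t'_def)
      have "pt t' \<in> D \<inter> ball x \<xi>"
        using t' t dist_pt_le[OF t(1) t', of k] cw' k by (auto simp: D_def)
      then have "pt t' \<in> D" "pt t' \<in> open_nbhd H (\<beta> * \<xi>)" using emp by auto
      then obtain z where z: "a \<bullet> z = c" "dist (pt t') z < \<beta> * \<xi>" by (auto simp: open_nbhd_def a)
      have "\<bar>a \<bullet> pt t' - c\<bar> = \<bar>a \<bullet> (pt t' - z)\<bar>" using z by (simp add: inner_diff_right)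
      also have "\<dots> \<le> norm a * norm (pt t' - z)" by (rule Cauchy_Schwarz_ineq2)
      also have "\<dots> < norm a * (\<beta> * \<xi>)" using z a by (simp add: dist_norm)
      finally have 1: "\<bar>a \<bullet> pt t' - c\<bar> < norm a * (\<beta> * \<xi>)" .
      let ?n = "length v0 + N * k"
      have len: "length (cw t k) = ?n" using t by (simp add: length_cw)
      have "2 \<le> length (e (cw t k) n)" using arg_cong[OF n(2), of length] by simp
      moreover have Suc: "cw t' (Suc k) = cw t k @ e (cw t k) n" using cw' by (simp add: t'_def)
      ultimately have "?n + 2 \<le> length (cw t' (Suc k))" using len by simp
      then have "map (iw t') [0..<?n + 2] = take (?n + 2) (cw t' (Suc k))"
        by (rule map_iw_take[OF t'])
      also have "\<dots> = (cw t k @ [j]) @ [j]" by (simp only: Suc take_append len) (simp add: n len)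
      finally have *: "map (iw t') [0..<?n + 2] = (cw t k @ [j]) @ [j]" .
      have num: "code_num b i ((cw t k @ [j]) @ [j]) = code_num b i (cw t k) * b ^ 2 + j i * b + j i" for i
        by (simp only: code_num_snoc) (simp add: power2_eq_square algebra_simps)
      have pow: "real b ^ (?n + 2) = real b ^ 2 / r k" by (simp add: r_def power_add power2_eq_square)
      have "real (code_num b i (cw t k) * b ^ 2 + j i * b + j i) * r k / b ^ 2 \<le> pt t' $ i \<and> 
          pt t' $ i \<le> real (code_num b i (cw t k) * b ^ 2 + j i * b + j i + 1) * r k / b ^ 2" for i
        using gamma_b_bounds[OF b iw_alphabet[OF t'] *, of i]
        unfolding num pt_def pow by (simp only: divide_divide_eq_right of_nat_add of_nat_1 of_nat_power simp_thms)
      then show ?thesis using 1 \<open>pt t' \<in> D\<close> by blast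
    qed
    define j1 j2 :: "'n \<Rightarrow> nat" where "j1 = (\<lambda>i. if a $ i \<ge> 0 then b - 1 else 0)"
      and "j2 = (\<lambda>i. if a $ i \<ge> 0 then 0 else b - 1)"
    have "j1 \<in> alphabet b" "j2 \<in> alphabet b" using b by (auto simp: j1_def j2_def alphabet_def)
    from near[OF this(1)] near[OF this(2)] obtain y1 y2 where
      y1: "\<bar>a \<bullet> y1 - c\<bar> < norm a * (\<beta> * \<xi>)"
         "\<And>i. real (code_num b i (cw t k) * b ^ 2 + j1 i * b + j1 i) * r k / b ^ 2 \<le> y1 $ i"
         "\<And>i. y1 $ i \<le> real (code_num b i (cw t k) * b ^ 2 + j1 i * b + j1 i + 1) * r k / b ^ 2" and
      y2: "\<bar>a \<bullet> y2 - c\<bar> < norm a * (\<beta> * \<xi>)"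
         "\<And>i. real (code_num b i (cw t k) * b ^ 2 + j2 i * b + j2 i) * r k / b ^ 2 \<le> y2 $ i"
         "\<And>i. y2 $ i \<le> real (code_num b i (cw t k) * b ^ 2 + j2 i * b + j2 i + 1) * r k / b ^ 2"
      by metis
    \<comment> \<open>In units of \<open>r k\<close>, opposite corner subcubes two generations down
      are \<open>1 - 2 / b^2\<close> apart in each coordinate, at least one half as
      \<open>b \<ge> 2\<close>. One generation down the gap would be \<open>1 - 2 / b\<close>, which
      vanishes for \<open>b = 2\<close>; hence the doubled letters.\<close>
    have gap: "u - v \<ge> r k / 2"
      if u: "real (q * b ^ 2 + (b - 1) * b + (b - 1)) * r k / b ^ 2 \<le> u"
        and v: "v \<le> real (q * b ^ 2 + 0 * b + 0 + 1) * r k / b ^ 2" for q u v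
    proof -
      have b4: "real b ^ 2 \<ge> 4" using b power_mono[of 2 "real b" 2] by simp
      have "real (q * b ^ 2 + (b - 1) * b + (b - 1)) = real q * real b ^ 2 + real b ^ 2 - 1"
      proof -
        have "real (b - 1) = real b - 1" using b by (simp add: of_nat_diff)
        then show ?thesis
          by (simp only: of_nat_add of_nat_mult of_nat_power) (simp add: power2_eq_square algebra_simps)
      qed
      note u = u[unfolded this]
      have "real (q * b ^ 2 + 0 * b + 0 + 1) = real q * real b ^ 2 + 1" by simp
      note v = v[unfolded this]
      have "u - v \<ge> (real q * real b ^ 2 + real b ^ 2 - 1) * r k / real b ^ 2 - (real q * real b ^ 2 + 1) * r k / real b ^ 2"
        using diff_mono[OF u v] by simp
      also have "(real q * real b ^ 2 + real b ^ 2 - 1) * r k / real b ^ 2 - (real q * real b ^ 2 + 1) * r k / real b ^ 2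
         = r k * (1 - 2 / real b ^ 2)"
        using b by (simp add: field_simps)
      finally have "u - v \<ge> r k * (1 - 2 / real b ^ 2)" .
      moreover have "r k * (1 - 2 / real b ^ 2) \<ge> r k * (1 / 2)"
        using r_pos[of k] b4 frac_le[of 2 2 4 "(real b)\<^sup>2"] by (intro mult_left_mono) auto
      ultimately have "r k * (1 / 2) \<le> u - v" by (rule order_trans[rotated])
      then show ?thesis by simp
    qed
    have comp: "\<bar>a $ i\<bar> * (r k / 2) \<le> a $ i * (y1 - y2) $ i" for i
    proof (cases "a $ i \<ge> 0")
      case True
      have "y1 $ i - y2 $ i \<ge> r k / 2"
        using y1(2)[of i] y2(3)[of i] True by (intro gap) (auto simp: j1_def j2_def)
      then have "a $ i * (r k / 2) \<le> a $ i * (y1 $ i - y2 $ i)" using True by (intro mult_left_mono)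
      then show ?thesis using True by simp
    next
      case False
      have "y2 $ i - y1 $ i \<ge> r k / 2"
        using y2(2)[of i] y1(3)[of i] False by (intro gap) (auto simp: j1_def j2_def)
      then have "(- a $ i) * (r k / 2) \<le> (- a $ i) * (y2 $ i - y1 $ i)" using False by (intro mult_left_mono) auto
      then show ?thesis using False by (simp add: algebra_simps)
    qed
    have "norm a * (r k / 2) \<le> (\<Sum>i\<in>UNIV. \<bar>a $ i\<bar>) * (r k / 2)"
      using r_pos[of k] by (intro mult_right_mono norm_le_l1_cart) simp
    also have "\<dots> \<le> a \<bullet> (y1 - y2)"
      unfolding sum_distrib_right inner_vec_def by (intro sum_mono) (use comp in simp)
    also have "\<dots> < norm a * (2 * (\<beta> * \<xi>))"
      using y1(1) y2(1) by (simp add: inner_diff_right algebra_simps abs_less_iff)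
    also have "\<dots> \<le> norm a * (r k / 2)"
      using k C by (intro mult_left_mono) (auto simp: \<beta>_def field_simps)
    finally show False by simp
  qed
  show ?thesis
    unfolding hyperplane_diffuse_def
    using C main compact_D
    by (intro conjI compact_imp_closed exI[of _ \<beta>] exI[of _ "1::real"]) (auto simp: \<beta>_def)
qed

end

subsection \<open>Hausdorff dimension\<close>

text \<open>Covering sets of diameter \<^term>\<open>0::real\<close> need separate treatment: they are not contained in
  balls of comparable radius, but they are null sets.\<close>

lemma hausdorff_measure_pos:
  fixes A :: "'a::metric_space set" and \<mu> :: "'a measure"
  assumes sets: "sets \<mu> = sets borel" and A: "emeasure \<mu> A > 0" and s: "0 \<le> s" "s < d"
    and c: "c > 0" and ball: "\<And>x \<rho>. 0 < \<rho> \<Longrightarrow> \<rho> < 1 \<Longrightarrow> emeasure \<mu> (ball x \<rho>) \<le> ennreal (c * \<rho> powr d)"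
  shows "hausdorff_measure s A > 0"
proof -
  define C where "C = c * 2 powr d"
  have C: "C > 0" using c by (simp add: C_def)
  have null: "emeasure \<mu> {x} = 0" for x
  proof -
    have "emeasure \<mu> {x} \<le> ennreal \<epsilon>" if \<epsilon>: "\<epsilon> > 0" for \<epsilon>
    proof -
      define \<rho> where "\<rho> = min (1 / 2) ((\<epsilon> / c) powr (1 / d))"
      have \<rho>: "0 < \<rho>" "\<rho> < 1" using \<epsilon> c by (auto simp: \<rho>_def)
      have "\<rho> powr d \<le> ((\<epsilon> / c) powr (1 / d)) powr d"
        using \<rho> s by (intro powr_mono2) (auto simp: \<rho>_def)
      also have "\<dots> = \<epsilon> / c" using s \<epsilon> c by (simp add: powr_powr)
      finally have le: "c * \<rho> powr d \<le> \<epsilon>" using c by (simp add: pos_le_divide_eq mult.commute)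
      have "emeasure \<mu> {x} \<le> emeasure \<mu> (ball x \<rho>)" using \<rho> by (intro emeasure_mono) (auto simp: sets)
      also have "\<dots> \<le> ennreal (c * \<rho> powr d)" by (rule ball) (use \<rho> in auto)
      also have "\<dots> \<le> ennreal \<epsilon>" using le by (rule ennreal_leI)
      finally show ?thesis .
    qed
    then have "emeasure \<mu> {x} \<le> 0 + ennreal \<epsilon>" if "\<epsilon> > 0" for \<epsilon>
      using that by simp
    then have "emeasure \<mu> {x} \<le> 0" by (rule ennreal_le_epsilon)
    then show ?thesis by simp
  qed
  \<comment> \<open>Diameters up to \<open>1 / 4\<close> keep the doubled radius below
    \<open>1\<close>, where the ball bound applies and the power with exponent \<open>d\<close> is
    at most the one with exponent \<open>s\<close>.\<close>
  have "emeasure \<mu> A \<le> ennreal C * (\<Sum>i. diam_pow s (U i))"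
    if cov: "A \<subseteq> (\<Union>i. U i)" and U: "\<And>i. bounded (U i)" "\<And>i. diameter (U i) \<le> 1 / 4" for U :: "nat \<Rightarrow> 'a set"
  proof -
    have "\<exists>V. V \<in> sets \<mu> \<and> U i \<subseteq> V \<and> emeasure \<mu> V \<le> ennreal C * diam_pow s (U i)" for i
    proof (cases "U i = {}")
      case True
      then show ?thesis by (intro exI[of _ "{}"]) simp
    next
      case False
      then obtain x where x: "x \<in> U i" by blast
      have dx: "dist x y \<le> diameter (U i)" if "y \<in> U i" for y
        by (rule diameter_bounded_bound) (use U x that in auto)
      have "diameter (U i) \<ge> 0" by (rule diameter_ge_0) (rule U)
      then consider "diameter (U i) = 0" | "diameter (U i) > 0" by linarith
      then show ?thesis
      proof cases
        case 1
        then have "U i \<subseteq> {x}" using dx by force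
        then show ?thesis by (intro exI[of _ "{x}"]) (simp add: null sets)
      next
        case 2
        let ?\<rho> = "2 * diameter (U i)"
        have "U i \<subseteq> ball x ?\<rho>"
        proof
          fix y assume "y \<in> U i"
          then show "y \<in> ball x ?\<rho>" using dx[of y] 2 by simp
        qed
        moreover have "emeasure \<mu> (ball x ?\<rho>) \<le> ennreal C * diam_pow s (U i)"
        proof -
          have "emeasure \<mu> (ball x ?\<rho>) \<le> ennreal (c * ?\<rho> powr d)"
            by (rule ball) (use 2 U(2)[of i] in auto)
          also have "c * ?\<rho> powr d = C * diameter (U i) powr d"
            using 2 by (simp add: C_def powr_mult)
          also have "ennreal \<dots> \<le> ennreal (C * diameter (U i) powr s)"
            using 2 U(2)[of i] s C by (intro ennreal_leI mult_left_mono powr_mono') auto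
          also have "\<dots> = ennreal C * diam_pow s (U i)"
            using 2 C False by (simp add: diam_pow_def ennreal_mult)
          finally show ?thesis .
        qed
        ultimately show ?thesis by (intro exI[of _ "ball x ?\<rho>"]) (simp add: sets)
      qed
    qed
    then obtain V where V: "\<And>i. V i \<in> sets \<mu>" "\<And>i. U i \<subseteq> V i"
      "\<And>i. emeasure \<mu> (V i) \<le> ennreal C * diam_pow s (U i)" by metis
    have "emeasure \<mu> A \<le> emeasure \<mu> (\<Union>i. V i)"
    proof (rule emeasure_mono)
      have "(\<Union>i. U i) \<subseteq> (\<Union>i. V i)" by (intro UN_mono V(2)) simp
      with cov show "A \<subseteq> (\<Union>i. V i)" by (rule order_trans)
      show "(\<Union>i. V i) \<in> sets \<mu>" using V(1) by (intro sets.countable_UN) auto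
    qed
    also have "\<dots> \<le> (\<Sum>i. emeasure \<mu> (V i))"
      using V(1) by (intro emeasure_subadditive_countably) auto
    also have "\<dots> \<le> (\<Sum>i. ennreal C * diam_pow s (U i))" by (intro suminf_le V(3)) auto
    also have "\<dots> = ennreal C * (\<Sum>i. diam_pow s (U i))" by (rule ennreal_suminf_cmult)
    finally show ?thesis .
  qed
  then have "emeasure \<mu> A / ennreal C \<le> hausdorff_content_delta s (1 / 4) A"
    unfolding hausdorff_content_delta_def using C
    by (intro INF_greatest) (auto simp: divide_le_posI_ennreal mult.commute)
  also have "\<dots> \<le> hausdorff_measure s A"
    unfolding hausdorff_measure_def by (rule SUP_upper) simp
  finally have "emeasure \<mu> A / ennreal C \<le> hausdorff_measure s A" .
  moreover have "emeasure \<mu> A / ennreal C > 0"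
    using A by (simp add: zero_less_iff_neq_zero ennreal_divide_eq_0_iff)
  ultimately show ?thesis by (rule less_le_trans[rotated])
qed

context block_code
begin

text \<open>Covering \<open>D\<close> by the \<open>L^k\<close> images of level \<open>k\<close>
  cylinders costs \<open>c * q ^ k\<close>, and \<open>q = b^(N * (\<delta> - s))\<close> is below
  \<open>1\<close> because \<open>s > \<delta>\<close>.\<close>

lemma hausdorff_measure_D_eq_0:
  assumes s: "s > \<delta>"
  shows "hausdorff_measure s D = 0"
proof -
  have s0: "s > 0" using s \<delta>_pos by simp
  have L0: "real L > 0" and b1: "real b > 1" using L b by auto
  define q where "q = real L * (1 / real b ^ N) powr s"
  define c where "c = (real CARD('n) * r 0) powr s"
  have "real L = real b powr (real N * \<delta>)"
    using b1 L0 N by (simp add: \<delta>_def)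
  moreover have "(1 / real b ^ N) powr s = real b powr (- (real N * s))"
    using b1 by (simp add: powr_minus_divide powr_powr[symmetric] powr_realpow powr_divide)
  ultimately have "q = real b powr (real N * \<delta> - real N * s)"
    by (simp add: q_def powr_add[symmetric])
  also have "\<dots> < real b powr 0"
    using s N b1 by (intro powr_less_mono) auto
  finally have q: "0 \<le> q" "q < 1" using L0 b1 by (auto simp: q_def)
  have cover_sum: "real L ^ k * (real CARD('n) * r k) powr s = c * q ^ k" for k
  proof -
    have "(real CARD('n) * r k) powr s = (real CARD('n) * r 0 * (1 / real b ^ N) ^ k) powr s"
      by (subst r_eq) (simp only: mult.assoc)
    also have "\<dots> = c * ((1 / real b ^ N) ^ k) powr s"
      unfolding c_def by (rule powr_mult)
    also have "((1 / real b ^ N) ^ k) powr s = ((1 / real b ^ N) powr s) ^ k"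
    proof -
      have "(x ^ k) powr s = (x powr s) ^ k" if "x > 0" for x :: real
        using that by (simp add: powr_realpow[symmetric] powr_powr mult.commute)
      then show ?thesis using b1 by simp
    qed
    finally show ?thesis by (simp add: q_def power_mult_distrib)
  qed
  have content: "hausdorff_content_delta s d D \<le> ennreal (c * q ^ k)"
    if k: "real CARD('n) * r k \<le> d" for d k
  proof -
    define P where "P = PiE {..<k} (\<lambda>_. {..<L})"
    have fin: "finite P" unfolding P_def by (rule finite_PiE) auto
    have cardP: "card P = L ^ k" unfolding P_def by (simp add: card_PiE)
    obtain h where h: "bij_betw h {..<L ^ k} P"
      using ex_bij_betw_nat_finite[OF fin] by (auto simp: cardP atLeast0LessThan)
    \<comment> \<open>The cover is padded to a sequence with empty sets, for which
      \<open>diam_pow\<close> is \<open>0\<close>.\<close>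
    define U where "U i = (if i < L ^ k then pt ` {t \<in> codes. restrict t {..<k} = h i} else {})" for i
    have cov: "D \<subseteq> (\<Union>i. U i)"
    proof
      fix x assume "x \<in> D"
      then obtain t where t: "t \<in> codes" "x = pt t" by (auto simp: D_def)
      then have "restrict t {..<k} \<in> P" by (auto simp: P_def codes_lt)
      then obtain i where "i < L ^ k" "restrict t {..<k} = h i"
        using h by (metis bij_betw_iff_bijections lessThan_iff)
      then have "x \<in> U i" using t by (auto simp: U_def)
      then show "x \<in> (\<Union>i. U i)" by blast
    qed
    have near: "dist x y \<le> real CARD('n) * r k" if xy: "x \<in> U i" "y \<in> U i" for x y i
    proof -
      have "U i \<subseteq> pt ` {t \<in> codes. restrict t {..<k} = h i}" by (simp add: U_def)
      then obtain t t' where t: "t \<in> codes" "t' \<in> codes" "x = pt t" "y = pt t'"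
        and h: "restrict t {..<k} = h i" "restrict t' {..<k} = h i"
        using xy by blast
      have eq: "restrict t {..<k} = restrict t' {..<k}" using h by simp
      have "cw t k = cw t' k"
      proof (rule cw_cong)
        fix l assume "l < k"
        then show "t l = t' l" using fun_cong[OF eq, of l] by simp
      qed
      then show ?thesis using t dist_pt_le by simp
    qed
    have bdd: "bounded (U i)" for i
      by (rule bounded_subset[of D]) (use compact_D compact_imp_bounded in \<open>auto simp: U_def D_def\<close>)
    have diam: "diameter (U i) \<le> real CARD('n) * r k" for i
      using near r_pos[of k] by (intro diameter_le) (auto simp: dist_norm)
    have "hausdorff_content_delta s d D \<le> (\<Sum>i. diam_pow s (U i))"
      unfolding hausdorff_content_delta_def
      by (rule INF_lower) (use cov bdd k in \<open>auto intro: order_trans[OF diam]\<close>)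
    also have "\<dots> = (\<Sum>i<L ^ k. diam_pow s (U i))"
      by (rule suminf_finite) (auto simp: U_def diam_pow_def)
    also have "\<dots> \<le> (\<Sum>i<L ^ k. ennreal ((real CARD('n) * r k) powr s))"
    proof (rule sum_mono)
      fix i
      have "diameter (U i) powr s \<le> (real CARD('n) * r k) powr s"
        using diam[of i] bdd[of i] s0 by (intro powr_mono2 diameter_ge_0) auto
      then show "diam_pow s (U i) \<le> ennreal ((real CARD('n) * r k) powr s)"
        using s0 by (auto simp: diam_pow_def intro: ennreal_leI)
    qed
    also have "\<dots> = ennreal (real L ^ k * (real CARD('n) * r k) powr s)"
      by (simp add: ennreal_mult ennreal_of_nat_eq_real_of_nat)
    finally show ?thesis by (simp add: cover_sum)
  qed
  have "hausdorff_content_delta s d D \<le> 0" if d: "d > 0" for d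
  proof -
    have "(\<lambda>k. real CARD('n) * r k) \<longlonglongrightarrow> real CARD('n) * 0" by (intro tendsto_intros r_tendsto)
    then have "\<forall>\<^sub>F k in sequentially. real CARD('n) * r k < d" using d by (intro order_tendstoD) auto
    then have ev: "\<forall>\<^sub>F k in sequentially. hausdorff_content_delta s d D \<le> ennreal (c * q ^ k)"
      by eventually_elim (intro content, simp)
    have "(\<lambda>k. c * q ^ k) \<longlonglongrightarrow> c * 0" using q by (intro tendsto_intros LIMSEQ_power_zero) auto
    then have "(\<lambda>k. ennreal (c * q ^ k)) \<longlonglongrightarrow> ennreal (c * 0)" by (intro tendsto_ennrealI)
    from tendsto_le[OF _ this tendsto_const ev] show ?thesis by simp
  qed
  then show ?thesis by (simp add: hausdorff_measure_def)
qed

lemma hausdorff_dim_D: "hausdorff_dim D = \<delta>"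
proof -
  obtain c2 where c2: "c2 > 0"
    "\<And>x \<rho>. 0 < \<rho> \<Longrightarrow> \<rho> < 1 \<Longrightarrow> emeasure \<mu> (ball x \<rho>) \<le> ennreal (c2 * \<rho> powr \<delta>)"
    using \<mu>_ball_le by blast
  have low: "\<delta> \<le> s" if "s \<ge> 0" "hausdorff_measure s D = 0" for s
  proof (rule ccontr)
    assume "\<not> \<delta> \<le> s"
    then have "hausdorff_measure s D > 0"
      using that c2 by (intro hausdorff_measure_pos[of \<mu> D s \<delta> c2]) (auto simp: emeasure_\<mu>_D)
    then show False using that by simp
  qed
  show ?thesis
    unfolding hausdorff_dim_def
  proof (rule antisym)
    let ?S = "{s. s \<ge> 0 \<and> hausdorff_measure s D = 0}"
    have in_S: "s \<in> ?S" if "s > \<delta>" for s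
      using that hausdorff_measure_D_eq_0[OF that] \<delta>_pos by simp
    show "\<delta> \<le> Inf ?S" using in_S[of "\<delta> + 1"] low by (intro cInf_greatest) auto
    \<comment> \<open>Vanishing is known only for exponents strictly above \<open>\<delta>\<close>,
      so the infimum is approached from above.\<close>
    show "Inf ?S \<le> \<delta>"
    proof (rule dense_ge)
      fix s assume "\<delta> < s"
      then show "Inf ?S \<le> s" by (intro cInf_lower in_S) (auto intro: bdd_belowI)
    qed
  qed
qed

end

subsection \<open>Regular subsets of the limit set\<close>

lemma alphabet_power_ge_2: "b \<ge> 2 \<Longrightarrow> 2 \<le> b ^ CARD('n::finite)" for b :: nat
  using power_increasing[of 1 "CARD('n)" b] by (simp add: Suc_le_eq)

text \<open>The count is cut down to exactly \<open>K\<close> per letter, so that every vertex gets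
  the same number of children, as the uniform measure requires; the prefix \<open>j j\<close> keeps
  the families of different letters disjoint.\<close>

lemma good_inf_children:
  fixes \<omega> :: "('n::finite \<Rightarrow> nat) list \<Rightarrow> bool"
  assumes good: "good_inf b n K \<omega>" and K: "K > 0"
  obtains f where "inj_on f {..<b ^ CARD('n) * K}"
    "\<And>i. i < b ^ CARD('n) * K \<Longrightarrow> f i \<in> words b (n + 2) \<and> in_tree b \<omega> (f i) \<and> good_inf b n K (sub (f i) \<omega>)"
    "\<And>j. j \<in> alphabet b \<Longrightarrow> \<exists>i < b ^ CARD('n) * K. take 2 (f i) = [j, j]"
proof -
  define G where "G j = {u. length u = n \<and> in_tree b (sub [j, j] \<omega>) u \<and> good_inf b n K (sub u (sub [j, j] \<omega>))}" for j
  have "\<forall>j\<in>alphabet b. \<exists>V. V \<subseteq> G j \<and> card V = K \<and> finite V"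
  proof
    fix j :: "'n \<Rightarrow> nat" assume j: "j \<in> alphabet b"
    have le: "K \<le> card (G j)"
      using good_infD(3)[OF good j] by (simp add: num_eq_card G_def)
    show "\<exists>V. V \<subseteq> G j \<and> card V = K \<and> finite V"
      by (rule obtain_subset_with_card_n[OF le]) blast
  qed
  from bchoice[OF this] obtain V where
    V: "j \<in> alphabet b \<Longrightarrow> V j \<subseteq> G j \<and> card (V j) = K \<and> finite (V j)" for j by blast
  define S where "S = (\<lambda>(j, u). [j, j] @ u) ` Sigma (alphabet b) V"
  have fin: "finite S" unfolding S_def using V by (intro finite_imageI finite_SigmaI) auto
  have "card S = card (Sigma (alphabet b) V)"
    unfolding S_def by (rule card_image) (auto simp: inj_on_def)
  also have "\<dots> = b ^ CARD('n) * K" using V by (simp add: card_SigmaI card_alphabet)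
  finally have card: "card S = b ^ CARD('n) * K" .
  obtain f where f: "bij_betw f {..<b ^ CARD('n) * K} S"
    using ex_bij_betw_nat_finite[OF fin] by (auto simp: card atLeast0LessThan)
  have S: "w \<in> words b (n + 2) \<and> in_tree b \<omega> w \<and> good_inf b n K (sub w \<omega>)" if "w \<in> S" for w
  proof -
    obtain j u where ju: "w = [j, j] @ u" "j \<in> alphabet b" "u \<in> V j" using \<open>w \<in> S\<close> by (auto simp: S_def)
    then have u: "length u = n" "in_tree b (sub [j, j] \<omega>) u" "good_inf b n K (sub u (sub [j, j] \<omega>))"
      using V unfolding G_def by blast+
    have "in_tree b \<omega> w"
      using u(2) ju good_infD(1,2)[OF good ju(2)] by (simp add: in_tree_Cons sub_sub sub_apply)
    moreover from this have "set w \<subseteq> alphabet b" by (simp add: in_tree_def)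
    ultimately show ?thesis using u ju by (simp add: words_def sub_sub)
  qed
  show ?thesis
  proof
    show "inj_on f {..<b ^ CARD('n) * K}" using f by (rule bij_betw_imp_inj_on)
    show "f i \<in> words b (n + 2) \<and> in_tree b \<omega> (f i) \<and> good_inf b n K (sub (f i) \<omega>)"
      if "i < b ^ CARD('n) * K" for i
      by (rule S) (use bij_betwE[OF f] that in simp)
    show "\<exists>i < b ^ CARD('n) * K. take 2 (f i) = [j, j]" if j: "j \<in> alphabet b" for j
    proof -
      have "V j \<noteq> {}" using V[OF j] K by auto
      then obtain u where "u \<in> V j" by blast
      then have "[j, j] @ u \<in> S" using j by (force simp: S_def)
      then obtain i where "i < b ^ CARD('n) * K" "f i = [j, j] @ u"
        using bij_betw_imp_surj_on[OF f] by (metis imageE lessThan_iff)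
      then show ?thesis by (intro exI[of _ i]) simp
    qed
  qed
qed

lemma exists_regular_subset:
  fixes \<omega> :: "('n::finite \<Rightarrow> nat) list \<Rightarrow> bool"
  assumes b: "b \<ge> 2" and K: "K > 0" and v: "in_tree b \<omega> v" "good_inf b n K (sub v \<omega>)"
  shows "\<exists>D :: (real ^ 'n) set. D \<subseteq> limit_set b \<omega> \<and> hyperplane_diffuse D \<and> ahlfors_regular D \<and>
    hausdorff_dim D = log (real b) (real (b ^ CARD('n) * K)) / real (n + 2)"
proof -
  let ?L = "b ^ CARD('n) * K"
  let ?good = "\<lambda>w. good_inf b n K (sub w \<omega>)"
  define children where "children w g \<longleftrightarrow> inj_on g {..<?L} \<and>
    (\<forall>i<?L. g i \<in> words b (n + 2) \<and> in_tree b (sub w \<omega>) (g i) \<and> good_inf b n K (sub (g i) (sub w \<omega>))) \<and>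
    (\<forall>j\<in>alphabet b. \<exists>i<?L. take 2 (g i) = [j, j])" for w and g :: "nat \<Rightarrow> ('n \<Rightarrow> nat) list"
  have "\<exists>g. ?good w \<longrightarrow> children w g" for w
  proof (cases "?good w")
    case True
    then show ?thesis by (rule good_inf_children[OF _ K]) (unfold children_def, blast)
  qed simp
  then obtain f where "\<And>w. ?good w \<Longrightarrow> children w (f w)" by metis
  then have f: "\<And>w. ?good w \<Longrightarrow> inj_on (f w) {..<?L}"
    "\<And>w i. ?good w \<Longrightarrow> i < ?L \<Longrightarrow> f w i \<in> words b (n + 2)"
    "\<And>w i. ?good w \<Longrightarrow> i < ?L \<Longrightarrow> in_tree b (sub w \<omega>) (f w i)"
    "\<And>w i. ?good w \<Longrightarrow> i < ?L \<Longrightarrow> good_inf b n K (sub (f w i) (sub w \<omega>))"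
    "\<And>w j. ?good w \<Longrightarrow> j \<in> alphabet b \<Longrightarrow> \<exists>i<?L. take 2 (f w i) = [j, j]"
    unfolding children_def by blast+
  \<comment> \<open>Words that are not good are never reached from \<^term>\<open>v\<close>; they get the children of \<^term>\<open>v\<close>.\<close>
  define e where "e w = f (if ?good w then w else v)" for w
  interpret block_code b "n + 2" ?L v e
  proof
    show "2 \<le> ?L" using mult_le_mono[of 2 "b ^ CARD('n)" 1 K] alphabet_power_ge_2[OF b, where 'n='n] K by simp
    show "set v \<subseteq> alphabet b" using v by (simp add: in_tree_def)
  qed (use b f v in \<open>auto simp: e_def\<close>)
  have inv: "in_tree b \<omega> (cw t k) \<and> ?good (cw t k)" if t: "t \<in> codes" for t k
  proof (induction k)
    case (Suc k)
    then have "e (cw t k) = f (cw t k)" by (simp add: e_def[of "cw t k"])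
    with Suc show ?case
      using f(3,4)[of "cw t k" "t k"] codes_lt[OF t, of k] by (simp add: in_tree_append sub_sub)
  qed (use v in simp)
  have "D \<subseteq> limit_set b \<omega>"
  proof
    fix x assume "x \<in> D"
    then obtain t where t: "t \<in> codes" "x = gamma_b b (iw t)" by (auto simp: D_def pt_def)
    have "in_tree b \<omega> (map (iw t) [0..<l])" for l
    proof -
      have "l \<le> length (cw t l)" using length_cw[OF t(1), of l] by (simp add: trans_le_add2)
      from map_iw_take[OF t(1) this] show ?thesis using in_tree_take[of b \<omega> "cw t l" l] inv[OF t(1), of l] by simp
    qed
    then show "x \<in> limit_set b \<omega>" using t by (auto simp: limit_set_def tree_boundary_def)
  qed
  then show ?thesis
    using hyperplane_diffuse_D ahlfors_regular_D hausdorff_dim_D unfolding \<delta>_def by blast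
qed

section \<open>Choice of the parameters and convergence of the dimensions\<close>

text \<open>The block dimensions are not shown to increase with \<open>n\<close>. Some subsequence
  is monotone, and a decreasing one would stay above its limit, against
  \<open>d n < l\<close>.\<close>

lemma incseq_subseq_below_limit:
  fixes d :: "nat \<Rightarrow> real"
  assumes lim: "d \<longlonglongrightarrow> l" and lt: "\<And>n. d n < l"
  obtains f where "strict_mono f" "incseq (d \<circ> f)"
proof -
  obtain f where f: "strict_mono f" "monoseq (\<lambda>n. d (f n))" using seq_monosub by blast
  have lim': "(d \<circ> f) \<longlonglongrightarrow> l" by (rule LIMSEQ_subseq_LIMSEQ[OF lim f(1)])
  have "\<not> decseq (d \<circ> f)"
    using decseq_ge[OF _ lim', of 0] lt[of "f 0"] by auto
  then have "incseq (d \<circ> f)" using f(2) by (auto simp: monoseq_iff comp_def)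
  with f(1) show ?thesis by (rule that)
qed

text \<open>The constants \<open>M\<close>, \<open>q\<close> and \<open>4\<close> shift the
  logarithm by a bounded amount, which division by \<open>n + 2\<close> removes in the limit. The
  strict upper bound is what excludes a decreasing subsequence.\<close>

lemma tendsto_block_dim:
  fixes a m q M :: real and K :: "nat \<Rightarrow> real"
  assumes "a > 1" "m > 1" "q > 0" "M > 0"
    and low: "\<And>n. n \<ge> l \<Longrightarrow> q * m ^ n / 4 \<le> K n"
    and up: "\<And>n. n \<ge> l \<Longrightarrow> M * K n < m ^ (n + 2)"
  shows "n \<ge> l \<Longrightarrow> log a (M * K n) / real (n + 2) < log a m"
    and "(\<lambda>n. log a (M * K n) / real (n + 2)) \<longlonglongrightarrow> log a m"
proof -
  have pos: "0 < M * (q * m ^ n / 4)" for n using assms by simp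
  have le: "M * (q * m ^ n / 4) \<le> M * K n" if "n \<ge> l" for n
    using low[OF that] assms by (intro mult_left_mono) auto
  show lt: "log a (M * K n) / real (n + 2) < log a m" if n: "n \<ge> l" for n
  proof -
    have "log a (M * K n) < log a (m ^ (n + 2))"
      using less_le_trans[OF pos le[OF n]] up[OF n] assms by (subst log_less_cancel_iff) auto
    also have "\<dots> = log a m * real (n + 2)" using assms by (subst log_nat_power) auto
    finally show ?thesis by (subst pos_divide_less_eq) auto
  qed
  show "(\<lambda>n. log a (M * K n) / real (n + 2)) \<longlonglongrightarrow> log a m"
  proof (rule tendsto_sandwich)
    have "log a (M * (q * m ^ n / 4)) = log a (M * q / 4) + real n * log a m" for n
    proof -
      have "log a (M * (q * m ^ n / 4)) = log a (M * q / 4 * m ^ n)" by (simp add: mult.assoc)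
      also have "\<dots> = log a (M * q / 4) + real n * log a m"
        using assms by (subst log_mult) (auto simp: log_nat_power)
      finally show ?thesis .
    qed
    then have "(log a (M * q / 4) + real n * log a m) / real (n + 2) \<le> log a (M * K n) / real (n + 2)"
      if "n \<ge> l" for n
      using log_mono[OF assms(1) pos le[OF that]] by (intro divide_right_mono) auto
    then show "\<forall>\<^sub>F n in sequentially. (log a (M * q / 4) + real n * log a m) / real (n + 2) 
        \<le> log a (M * K n) / real (n + 2)"
      by (auto simp: eventually_sequentially)
    show "\<forall>\<^sub>F n in sequentially. log a (M * K n) / real (n + 2) \<le> log a m"
      using lt by (auto simp: eventually_sequentially intro!: exI[of _ l] less_imp_le)
    show "(\<lambda>n. (log a (M * q / 4) + real n * log a m) / real (n + 2)) \<longlonglongrightarrow> log a m"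
    proof -
      have "(\<lambda>n. log a m + (log a (M * q / 4) - 2 * log a m) * (1 / real (n + 2)))
          \<longlonglongrightarrow> log a m + (log a (M * q / 4) - 2 * log a m) * 0"
        by (intro tendsto_intros LIMSEQ_ignore_initial_segment[OF lim_1_over_n, of 2])
      moreover have "log a m + (log a (M * q / 4) - 2 * log a m) * (1 / real (n + 2))
          = (log a (M * q / 4) + real n * log a m) / real (n + 2)" for n
        by (simp add: field_simps)
      ultimately show ?thesis by simp
    qed
  qed simp
qed

theorem theorem4p1:
  fixes b :: nat and p :: real
  assumes "b \<ge> 2" and "0 < p" and "p < 1"
    and "p * real b ^ CARD('n::finite) > 1"
  shows "AE \<omega> in (perc_space p :: (('n \<Rightarrow> nat) list \<Rightarrow> bool) measure).
           nonextinct b \<omega> \<longrightarrow>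
           (\<exists>D :: nat \<Rightarrow> (real ^ 'n) set.
              (\<forall>n. D n \<subseteq> limit_set b \<omega> \<and> hyperplane_diffuse (D n) \<and> ahlfors_regular (D n)) \<and>
              incseq (\<lambda>n. hausdorff_dim (D n)) \<and>
              (\<lambda>n. hausdorff_dim (D n)) \<longlonglongrightarrow> log (real b) (p * real b ^ CARD('n)))"
proof -
  define M where "M = real b ^ CARD('n)"
  define m where "m = p * M"
  define c where "c = 1 / (4 * (m / (m - 1) + 1))"
  define q where "q = (p\<^sup>2 * c) ^ (b ^ CARD('n))"
  define K where "K n = nat \<lfloor>q * m ^ n / 2\<rfloor>" for n
  have m: "m > 1" using assms by (simp add: m_def M_def)
  have M2: "2 \<le> b ^ CARD('n)" by (rule alphabet_power_ge_2[OF assms(1)])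
  have M: "M \<ge> 2" unfolding M_def using M2 by (metis of_nat_le_iff of_nat_numeral of_nat_power)
  have "m / (m - 1) > 0" using m by simp
  then have c: "0 < c" "c \<le> 1" by (auto simp: c_def divide_simps)
  have q0: "q > 0" using c assms by (simp add: q_def)
  have "q \<le> p\<^sup>2"
  proof -
    have "p\<^sup>2 * c \<le> 1" using c assms by (intro mult_le_one power_le_one) auto
    then have "q \<le> (p\<^sup>2 * c) ^ 1"
      unfolding q_def using c M2 by (intro power_decreasing) auto
    also have "\<dots> \<le> p\<^sup>2 * 1" using c by (simp add: mult_left_le)
    finally show ?thesis by simp
  qed
  \<comment> \<open>Once \<open>q * m ^ n \<ge> 4\<close>, rounding \<open>q * m ^ n / 2\<close>
    down loses at most half of it, \<open>K n\<close> is positive, and the second moment bound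
    applies.\<close>
  obtain n0 where "4 / q < m ^ n0" using real_arch_pow[OF m] by blast
  then have n0: "4 \<le> q * m ^ n" if "n \<ge> n0" for n
  proof -
    have "q * m ^ n0 \<le> q * m ^ n" using that m q0 by (intro mult_left_mono power_increasing) auto
    moreover have "4 < q * m ^ n0" using \<open>4 / q < m ^ n0\<close> q0 by (simp add: divide_less_eq mult.commute)
    ultimately show ?thesis by linarith
  qed
  have K: "real (K n) \<le> q * m ^ n / 2" "q * m ^ n / 4 \<le> real (K n)" if "n \<ge> n0" for n
  proof -
    have "real (K n) = of_int \<lfloor>q * m ^ n / 2\<rfloor>" using n0[OF that] by (simp add: K_def)
    then show "real (K n) \<le> q * m ^ n / 2" "q * m ^ n / 4 \<le> real (K n)"
      using n0[OF that] floor_correct[of "q * m ^ n / 2"] by linarith+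
  qed
  have Kpos: "K n > 0" if "n \<ge> n0" for n
    using K(2)[OF that] n0[OF that] by (cases "K n") auto
  \<comment> \<open>By \<open>q \<le> p\<^sup>2\<close> the left side is at most half of
    \<open>p^2 * M * m^n\<close>, while the right side is \<open>p^2 * M^2 * m^n\<close>.\<close>
  have up: "M * real (K n) < m ^ (n + 2)" if "n \<ge> n0" for n
  proof -
    have "M * real (K n) \<le> M * (q * m ^ n / 2)" using K(1)[OF that] M by (intro mult_left_mono) auto
    also have "\<dots> \<le> M * (p\<^sup>2 * m ^ n / 2)"
      using \<open>q \<le> p\<^sup>2\<close> M m by (intro mult_left_mono divide_right_mono mult_right_mono) auto
    also have "\<dots> = (p\<^sup>2 * m ^ n) * (M / 2)" by simp
    also have "\<dots> < (p\<^sup>2 * m ^ n) * M\<^sup>2"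
    proof (rule mult_strict_left_mono)
      have "M * 1 \<le> M * M" using M by (intro mult_left_mono) auto
      then show "M / 2 < M\<^sup>2" using M unfolding power2_eq_square by linarith
      show "0 < p\<^sup>2 * m ^ n" using assms m by simp
    qed
    also have "\<dots> = m ^ (n + 2)" by (simp add: m_def power_add power_mult_distrib power2_eq_square mult_ac)
    finally show ?thesis .
  qed
  define d where "d n = log (real b) (M * real (K n)) / real (n + 2)" for n
  have b1: "real b > 1" and Mpos: "M > 0" using assms(1) M by auto
  note dim = tendsto_block_dim[where K="\<lambda>n. real (K n)" and l=n0, OF b1 m q0 Mpos K(2) up]
  have d: "d \<longlonglongrightarrow> log (real b) m" unfolding d_def by (rule dim(2))
  have d0: "(\<lambda>k. d (k + n0)) \<longlonglongrightarrow> log (real b) m" by (rule LIMSEQ_ignore_initial_segment[OF d])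
  have lt: "d (k + n0) < log (real b) m" for k unfolding d_def by (rule dim(1)) (auto intro: le_add2)
  obtain f where f: "strict_mono f" "incseq ((\<lambda>k. d (k + n0)) \<circ> f)"
    by (rule incseq_subseq_below_limit[OF d0 lt])
  \<comment> \<open>A single null set must serve all \<open>k\<close>, so the countable quantifier
    is placed inside the almost sure statement.\<close>
  have "AE \<omega> in (perc_space p :: (('n \<Rightarrow> nat) list \<Rightarrow> bool) measure). \<forall>k.
      nonextinct b \<omega> \<longrightarrow> (\<exists>v. in_tree b \<omega> v \<and> good_inf b (k + n0) (K (k + n0)) (sub v \<omega>))"
    unfolding AE_all_countable
  proof
    fix k
    let ?n = "k + n0"
    have "0 < q" by (rule q0)
    also have "q \<le> measure (perc_space p) {\<omega> :: ('n \<Rightarrow> nat) list \<Rightarrow> bool. good_inf b ?n (K ?n) \<omega>}"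
    proof (rule prob_good_inf_ge, rule prob_good_ge)
      show "m = p * real b ^ CARD('n)" by (simp add: m_def M_def)
      show "q = (p\<^sup>2 * (1 / (4 * (m / (m - 1) + 1)))) ^ b ^ CARD('n)" by (simp add: q_def c_def)
      show "1 \<le> q * m ^ ?n" using n0[of ?n] le_add2[of n0 k] by simp
      show "real (K ?n) \<le> q * m ^ ?n / 2" by (rule K) (rule le_add2)
    qed (use assms m in auto)
    finally have pos: "0 < measure (perc_space p) {\<omega> :: ('n \<Rightarrow> nat) list \<Rightarrow> bool. good_inf b ?n (K ?n) \<omega>}" .
    show "AE \<omega> in (perc_space p :: (('n \<Rightarrow> nat) list \<Rightarrow> bool) measure).
      nonextinct b \<omega> \<longrightarrow> (\<exists>v. in_tree b \<omega> v \<and> good_inf b ?n (K ?n) (sub v \<omega>))"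
      by (rule AE_nonextinct_imp_good[OF assms(2,3,1) Kpos pos]) (rule le_add2)
  qed
  then show ?thesis
  proof eventually_elim
    case (elim \<omega>)
    show ?case
    proof
      assume "nonextinct b \<omega>"
      have "\<exists>D :: (real ^ 'n) set. D \<subseteq> limit_set b \<omega> \<and> hyperplane_diffuse D \<and> ahlfors_regular D \<and>
          hausdorff_dim D = d (k + n0)" for k
      proof -
        obtain v where "in_tree b \<omega> v" "good_inf b (k + n0) (K (k + n0)) (sub v \<omega>)"
          using elim \<open>nonextinct b \<omega>\<close> by blast
        from exists_regular_subset[OF assms(1) Kpos[OF le_add2] this] show ?thesis by (simp add: d_def M_def)
      qed
      then obtain D :: "nat \<Rightarrow> (real ^ 'n) set" where D: "\<And>k. D k \<subseteq> limit_set b \<omega>"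
          "\<And>k. hyperplane_diffuse (D k)" "\<And>k. ahlfors_regular (D k)" "\<And>k. hausdorff_dim (D k) = d (k + n0)"
        by metis
      from LIMSEQ_subseq_LIMSEQ[OF d0 f(1)]
      have "(\<lambda>k. hausdorff_dim (D (f k))) \<longlonglongrightarrow> log (real b) (p * real b ^ CARD('n))"
        by (simp add: D(4) comp_def m_def M_def)
      moreover have "incseq (\<lambda>k. hausdorff_dim (D (f k)))" using f(2) by (simp add: D(4) comp_def)
      ultimately show "\<exists>D :: nat \<Rightarrow> (real ^ 'n) set.
              (\<forall>n. D n \<subseteq> limit_set b \<omega> \<and> hyperplane_diffuse (D n) \<and> ahlfors_regular (D n)) \<and>
              incseq (\<lambda>n. hausdorff_dim (D n)) \<and>
              (\<lambda>n. hausdorff_dim (D n)) \<longlonglongrightarrow> log (real b) (p * real b ^ CARD('n))"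
        using D(1-3) by (intro exI[of _ "\<lambda>k. D (f k)"]) auto
    qed
  qed
qed

end
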